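(* Let $M \geq 0$ and $d \in \{2,3,\dots\}$. Let $(G_n,o_n)_{n\geq 0}$ be a sequence of unbiased random rooted graphs such that, almost surely, for all $n \geq 0$, $G_n$ is $M$-uniform in dimension $d$. If $(G_n,o_n)$ converges in distribution (with respect to the local metric $\Delta$) to a random rooted graph $(G,o)$, then $G$ is almost surely $d$-parabolic.
   Context: All graphs are locally finite and connected. Sphere packings. A $d$-sphere packing is a collection $P=(B_v, v\in V)$ of $d$-dimensional closed balls in $\mathbb{R}^d$ with radii $r_v>0$ and pairwise disjoint interiors. Its tangency graph is the unoriented graph with vertex set $V$ in which distinct $u,v$ are joined by an edge if and only if $B_u$ and $B_v$ are tangent. The packing is $M$-uniform if for any tangent balls $B_u,B_v$ one has $r_u/r_v \leq M$. A graph is $M$-uniform in dimension $d$ if it is (isomorphic to) the tangency graph of an $M$-uniform $d$-sphere packing in $\mathbb{R}^d$. Local convergence. A rooted graph is a pair $(G,o)$ with $o$ a vertex of $G$; isomorphisms of rooted graphs are graph isomorphisms preserving the root. On the space of isomorphism classes of locally finite rooted graphs put the distance $$\Delta\big((G,o),(G',o')\big)=\Big(1+\sup\{k : \mathrm{Ball}_G(o,k)\text{ is isomorphic, as a rooted graph, to }\mathrm{Ball}_{G'}(o',k)\}\Big)^{-1},$$ where $\mathrm{Ball}_G(o,k)$ is the closed ball of radius $k$ around $o$ for the graph distance (with $\Delta=0$ if the supremum is infinite). A random rooted graph is a random variable with values in this space. Unbiased. A random rooted graph $(G,o)$ is unbiased if $G$ is almost surely finite and, conditionally on $G$, the root $o$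 is uniformly distributed over the vertices of $G$. $d$-parabolicity. Let $G=(V,E)$ be a locally finite connected graph and $v\in V$. Let $\Gamma(v)$ be the set of all semi-infinite paths in $G$ starting from $v$, i.e. sequences $v=v_0,v_1,v_2,\dots$ of pairwise distinct vertices with consecutive vertices adjacent. For $m:V\to\mathbb{R}_+$ set $\mathrm{Length}_m(\gamma)=\sum_{u\in\gamma} m(u)$ and $\|m\|_d=(\sum_{u\in V} m(u)^d)^{1/d}$. The $d$-vertex extremal length is $$d\text{-}\mathrm{VEL}(\Gamma(v))=\sup_m \inf_{\gamma\in\Gamma(v)}\frac{\mathrm{Length}_m(\gamma)^d}{\|m\|_d^d},$$ the supremum being over $m:V\to\mathbb{R}_+$ with $0<\|m\|_d<\infty$. The graph $G$ is $d$-parabolic if $d\text{-}\mathrm{VEL}(\Gamma(v))=\infty$; this does not depend on the choice of $v$. (With $\inf\varnothing=+\infty$, finite graphs are $d$-parabolic.) *)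

theory Defs
  imports "HOL-Probability.Probability"
begin

section \<open>Locally finite connected graphs\<close>

record 'v ugraph =
  verts :: "'v set"
  edges :: "'v set set"

definition simple_graph :: "'v ugraph \<Rightarrow> bool" where
  "simple_graph G \<longleftrightarrow>
     (\<forall>e\<in>edges G. \<exists>u v. u \<in> verts G \<and> v \<in> verts G \<and> u \<noteq> v \<and> e = {u, v})"

definition locally_finite_graph :: "'v ugraph \<Rightarrow> bool" where
  "locally_finite_graph G \<longleftrightarrow> (\<forall>v\<in>verts G. finite {u. {v, u} \<in> edges G})"

definition adj_rel :: "'v ugraph \<Rightarrow> ('v \<times> 'v) set" where
  "adj_rel G = {(u, v). {u, v} \<in> edges G}"

definition connected_graph :: "'v ugraph \<Rightarrow> bool" where
  "connected_graph G \<longleftrightarrow> (\<forall>u\<in>verts G. \<forall>v\<in>verts G. (u, v) \<in> (adj_rel G)\<^sup>*)"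

text \<open>Only meaningful for vertices of a connected graph.\<close>

definition graph_dist :: "'v ugraph \<Rightarrow> 'v \<Rightarrow> 'v \<Rightarrow> nat" where
  "graph_dist G u v = (LEAST n. (u, v) \<in> adj_rel G ^^ n)"

definition graph_iso_map :: "('v \<Rightarrow> 'u) \<Rightarrow> 'v ugraph \<Rightarrow> 'u ugraph \<Rightarrow> bool" where
  "graph_iso_map f G H \<longleftrightarrow> bij_betw f (verts G) (verts H) \<and>
     (\<forall>u\<in>verts G. \<forall>v\<in>verts G. {u, v} \<in> edges G \<longleftrightarrow> {f u, f v} \<in> edges H)"

definition graph_iso :: "'v ugraph \<Rightarrow> 'u ugraph \<Rightarrow> bool" where
  "graph_iso G H \<longleftrightarrow> (\<exists>f. graph_iso_map f G H)"

definition rooted_iso :: "'v ugraph \<times> 'v \<Rightarrow> 'u ugraph \<times> 'u \<Rightarrow> bool" where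
  "rooted_iso p q \<longleftrightarrow> (\<exists>f. graph_iso_map f (fst p) (fst q) \<and> f (snd p) = snd q)"

definition induced_subgraph :: "'v ugraph \<Rightarrow> 'v set \<Rightarrow> 'v ugraph" where
  "induced_subgraph G S = \<lparr>verts = verts G \<inter> S, edges = {e \<in> edges G. e \<subseteq> S}\<rparr>"

definition ball_verts :: "'v ugraph \<Rightarrow> 'v \<Rightarrow> nat \<Rightarrow> 'v set" where
  "ball_verts G x k = {v \<in> verts G. graph_dist G x v \<le> k}"

definition rooted_ball :: "'v ugraph \<times> 'v \<Rightarrow> nat \<Rightarrow> 'v ugraph \<times> 'v" where
  "rooted_ball p k = (induced_subgraph (fst p) (ball_verts (fst p) (snd p) k), snd p)"

definition is_rooted_graph :: "'v ugraph \<times> 'v \<Rightarrow> bool" where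
  "is_rooted_graph p \<longleftrightarrow> simple_graph (fst p) \<and> locally_finite_graph (fst p) \<and>
     connected_graph (fst p) \<and> snd p \<in> verts (fst p)"

section \<open>Uniform sphere packings\<close>

definition sphere_packing :: "'v set \<Rightarrow> ('v \<Rightarrow> 'a::euclidean_space) \<Rightarrow> ('v \<Rightarrow> real) \<Rightarrow> bool" where
  "sphere_packing V c r \<longleftrightarrow> (\<forall>v\<in>V. r v > 0) \<and>
     (\<forall>u\<in>V. \<forall>v\<in>V. u \<noteq> v \<longrightarrow>
        interior (cball (c u) (r u)) \<inter> interior (cball (c v) (r v)) = {})"

text \<open>Balls with disjoint interiors can only be externally tangent.\<close>

definition tangent_balls :: "('v \<Rightarrow> 'a::euclidean_space) \<Rightarrow> ('v \<Rightarrow> real) \<Rightarrow> 'v \<Rightarrow> 'v \<Rightarrow> bool" where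
  "tangent_balls c r u v \<longleftrightarrow> dist (c u) (c v) = r u + r v"

definition tangency_graph ::
  "'v set \<Rightarrow> ('v \<Rightarrow> 'a::euclidean_space) \<Rightarrow> ('v \<Rightarrow> real) \<Rightarrow> 'v ugraph" where
  "tangency_graph V c r =
     \<lparr>verts = V,
      edges = {{u, v} | u v. u \<in> V \<and> v \<in> V \<and> u \<noteq> v \<and> tangent_balls c r u v}\<rparr>"

definition uniform_packing ::
  "real \<Rightarrow> 'v set \<Rightarrow> ('v \<Rightarrow> 'a::euclidean_space) \<Rightarrow> ('v \<Rightarrow> real) \<Rightarrow> bool" where
  "uniform_packing M V c r \<longleftrightarrow>
     (\<forall>u\<in>V. \<forall>v\<in>V. tangent_balls c r u v \<longrightarrow> r u / r v \<le> M)"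

text \<open>
  The ambient space is passed as a type. The balls are indexed by elements of the vertex type
  of the graph, which is no restriction: an isomorphism from the tangency graph to \<open>G\<close>
  transports any index set to \<open>verts G\<close>.
\<close>

definition uniform_graph :: "'a::euclidean_space itself \<Rightarrow> real \<Rightarrow> 'v ugraph \<Rightarrow> bool" where
  "uniform_graph _ M G \<longleftrightarrow>
     (\<exists>(V :: 'v set) (c :: 'v \<Rightarrow> 'a) r.
        sphere_packing V c r \<and> uniform_packing M V c r \<and> graph_iso G (tangency_graph V c r))"

section \<open>Vertex extremal length and parabolicity\<close>

definition rays :: "'v ugraph \<Rightarrow> 'v \<Rightarrow> (nat \<Rightarrow> 'v) set" where
  "rays G v = {\<gamma>. \<gamma> 0 = v \<and> inj \<gamma> \<and> (\<forall>i. {\<gamma> i, \<gamma> (Suc i)} \<in> edges G)}"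

definition path_length :: "('v \<Rightarrow> real) \<Rightarrow> (nat \<Rightarrow> 'v) \<Rightarrow> ennreal" where
  "path_length m \<gamma> = (\<Sum>\<^sub>\<infinity>u\<in>range \<gamma>. ennreal (m u))"

text \<open>The norm is the expected one only when the sum converges; this is part of \<open>metrics\<close>.\<close>

definition vert_norm :: "nat \<Rightarrow> 'v ugraph \<Rightarrow> ('v \<Rightarrow> real) \<Rightarrow> real" where
  "vert_norm d G m = root d (\<Sum>\<^sub>\<infinity>u\<in>verts G. m u ^ d)"

definition metrics :: "nat \<Rightarrow> 'v ugraph \<Rightarrow> ('v \<Rightarrow> real) set" where
  "metrics d G = {m. (\<forall>u\<in>verts G. 0 \<le> m u) \<and>
     (\<lambda>u. m u ^ d) summable_on verts G \<and> 0 < vert_norm d G m}"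

text \<open>In \<^typ>\<open>ennreal\<close> the infimum over an empty set of rays is \<open>\<infinity>\<close>.\<close>

definition VEL :: "nat \<Rightarrow> 'v ugraph \<Rightarrow> 'v \<Rightarrow> ennreal" where
  "VEL d G v =
     (SUP m\<in>metrics d G. INF \<gamma>\<in>rays G v. path_length m \<gamma> ^ d / ennreal (vert_norm d G m ^ d))"

definition parabolic_graph :: "nat \<Rightarrow> 'v ugraph \<Rightarrow> bool" where
  "parabolic_graph d G \<longleftrightarrow> (\<forall>v\<in>verts G. VEL d G v = \<infinity>)"

section \<open>Isomorphism invariance\<close>

lemma simple_graph_edgeD:
  assumes "simple_graph G" "{u, v} \<in> edges G"
  shows "u \<in> verts G" "v \<in> verts G" "u \<noteq> v"
proof -
  from assms obtain a b where "a \<in> verts G" "b \<in> verts G" "a \<noteq> b" "{u, v} = {a, b}"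
    unfolding simple_graph_def by meson
  then show "u \<in> verts G" "v \<in> verts G" "u \<noteq> v" by (auto simp: doubleton_eq_iff)
qed

lemma simple_graph_no_loop: "simple_graph G \<Longrightarrow> {a} \<notin> edges G"
  using simple_graph_edgeD(3)[of G a a] by auto

lemma graph_iso_map_id: "graph_iso_map id G G"
  by (simp add: graph_iso_map_def)

lemma graph_iso_map_comp:
  assumes "graph_iso_map f G H" "graph_iso_map g H K"
  shows "graph_iso_map (g \<circ> f) G K"
  unfolding graph_iso_map_def
proof (intro conjI ballI)
  show "bij_betw (g \<circ> f) (verts G) (verts K)"
    using assms by (auto simp: graph_iso_map_def intro: bij_betw_trans)
  fix u v assume uv: "u \<in> verts G" "v \<in> verts G"
  then have "f u \<in> verts H" "f v \<in> verts H"
    using assms by (auto simp: graph_iso_map_def bij_betw_def)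
  then show "{u, v} \<in> edges G \<longleftrightarrow> {(g \<circ> f) u, (g \<circ> f) v} \<in> edges K"
    using assms uv by (simp add: graph_iso_map_def)
qed

lemma graph_iso_map_inv:
  assumes "graph_iso_map f G H"
  shows "graph_iso_map (inv_into (verts G) f) H G"
  unfolding graph_iso_map_def
proof (intro conjI ballI)
  have b: "bij_betw f (verts G) (verts H)" using assms by (simp add: graph_iso_map_def)
  show "bij_betw (inv_into (verts G) f) (verts H) (verts G)"
    using b by (rule bij_betw_inv_into)
  fix u v assume uv: "u \<in> verts H" "v \<in> verts H"
  let ?g = "inv_into (verts G) f"
  have "?g u \<in> verts G" "?g v \<in> verts G" "f (?g u) = u" "f (?g v) = v"
    using b uv by (auto simp: bij_betw_def inv_into_into f_inv_into_f)
  then show "{u, v} \<in> edges H \<longleftrightarrow> {?g u, ?g v} \<in> edges G"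
    using assms by (simp add: graph_iso_map_def)
qed

lemma graph_iso_refl: "graph_iso G G"
  unfolding graph_iso_def using graph_iso_map_id by blast

lemma graph_iso_sym: "graph_iso G H \<Longrightarrow> graph_iso H G"
  unfolding graph_iso_def using graph_iso_map_inv by blast

lemma graph_iso_trans: "graph_iso G H \<Longrightarrow> graph_iso H K \<Longrightarrow> graph_iso G K"
  unfolding graph_iso_def using graph_iso_map_comp by blast

lemma graph_iso_cong:
  assumes "graph_iso G H"
  shows "graph_iso G K \<longleftrightarrow> graph_iso H K"
  by (rule iffI) (erule graph_iso_trans[OF graph_iso_sym[OF assms]], erule graph_iso_trans[OF assms])

lemma rooted_iso_imp_iso: "rooted_iso p q \<Longrightarrow> graph_iso (fst p) (fst q)"
  unfolding rooted_iso_def graph_iso_def by blast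

lemma rooted_iso_refl: "rooted_iso p p"
  unfolding rooted_iso_def by (metis graph_iso_map_id id_apply)

lemma rooted_iso_sym:
  assumes "rooted_iso p q" "snd p \<in> verts (fst p)"
  shows "rooted_iso q p"
proof -
  from assms obtain f where f: "graph_iso_map f (fst p) (fst q)" "f (snd p) = snd q"
    unfolding rooted_iso_def by blast
  have "inv_into (verts (fst p)) f (snd q) = snd p"
    using f assms(2) by (auto simp: graph_iso_map_def bij_betw_def intro: inv_into_f_eq)
  with graph_iso_map_inv[OF f(1)] show ?thesis unfolding rooted_iso_def by blast
qed

lemma rooted_iso_trans:
  assumes "rooted_iso p q" "rooted_iso q s"
  shows "rooted_iso p s"
proof -
  from assms obtain f g where "graph_iso_map f (fst p) (fst q)" "f (snd p) = snd q"
    "graph_iso_map g (fst q) (fst s)" "g (snd q) = snd s"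
    unfolding rooted_iso_def by blast
  then show ?thesis unfolding rooted_iso_def
    by (intro exI[of _ "g \<circ> f"]) (auto intro: graph_iso_map_comp)
qed

lemma uniform_graph_iso:
  fixes G :: "'b ugraph" and H :: "'b ugraph"
  assumes "graph_iso G H"
  shows "uniform_graph T M G \<longleftrightarrow> uniform_graph T M H"
  unfolding uniform_graph_def graph_iso_cong[OF assms] by (rule refl)

lemma graph_iso_finite:
  assumes "graph_iso G H"
  shows "finite (verts G) \<longleftrightarrow> finite (verts H)"
  using assms unfolding graph_iso_def graph_iso_map_def by (auto dest: bij_betw_finite)

lemma VEL_iso_le:
  assumes f: "graph_iso_map f G H" and H: "simple_graph H" and v: "v \<in> verts G"
  shows "VEL d G v \<le> VEL d H (f v)"
  unfolding VEL_def
proof (rule SUP_mono)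
  fix m assume m: "m \<in> metrics d G"
  define g where "g = inv_into (verts G) f"
  have g: "graph_iso_map g H G" unfolding g_def by (rule graph_iso_map_inv[OF f])
  have gb: "bij_betw g (verts H) (verts G)" using g by (simp add: graph_iso_map_def)
  have gf: "g (f v) = v"
    using f v by (auto simp: g_def graph_iso_map_def bij_betw_def)
  have s: "(\<Sum>\<^sub>\<infinity>u\<in>verts H. (m \<circ> g) u ^ d) = (\<Sum>\<^sub>\<infinity>u\<in>verts G. m u ^ d)"
    using infsum_reindex_bij_betw[OF gb, of "\<lambda>u. m u ^ d"] by simp
  have s2: "(\<lambda>u. (m \<circ> g) u ^ d) summable_on verts H \<longleftrightarrow> (\<lambda>u. m u ^ d) summable_on verts G"
    using summable_on_reindex_bij_betw[OF gb, of "\<lambda>u. m u ^ d"] by simp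
  have n: "vert_norm d H (m \<circ> g) = vert_norm d G m"
    using s by (simp add: vert_norm_def)
  have mm: "m \<circ> g \<in> metrics d H"
    using m s2 n gb by (auto simp: metrics_def bij_betw_def)
  have "(INF \<gamma>\<in>rays G v. path_length m \<gamma> ^ d / ennreal (vert_norm d G m ^ d))
     \<le> (INF \<gamma>\<in>rays H (f v). path_length (m \<circ> g) \<gamma> ^ d / ennreal (vert_norm d H (m \<circ> g) ^ d))"
  proof (rule INF_mono)
    fix \<gamma> assume \<gamma>: "\<gamma> \<in> rays H (f v)"
    have vs: "\<gamma> i \<in> verts H" for i
      using \<gamma> simple_graph_edgeD(1)[OF H] by (auto simp: rays_def)
    have gi: "inj_on g (range \<gamma>)"
      using gb vs by (auto simp: bij_betw_def intro: inj_on_subset)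
    have "g \<circ> \<gamma> \<in> rays G v"
      using \<gamma> vs g gf gi by (auto simp: rays_def graph_iso_map_def intro: comp_inj_on)
    moreover have "path_length m (g \<circ> \<gamma>) = path_length (m \<circ> g) \<gamma>"
      using infsum_reindex[OF gi, of "\<lambda>u. ennreal (m u)"]
      by (simp add: path_length_def image_comp o_def)
    ultimately show "\<exists>\<gamma>'\<in>rays G v. path_length m \<gamma>' ^ d / ennreal (vert_norm d G m ^ d)
       \<le> path_length (m \<circ> g) \<gamma> ^ d / ennreal (vert_norm d H (m \<circ> g) ^ d)"
      using n by (intro bexI[of _ "g \<circ> \<gamma>"]) auto
  qed
  with mm show "\<exists>m'\<in>metrics d H.
     (INF \<gamma>\<in>rays G v. path_length m \<gamma> ^ d / ennreal (vert_norm d G m ^ d))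
     \<le> (INF \<gamma>\<in>rays H (f v). path_length m' \<gamma> ^ d / ennreal (vert_norm d H m' ^ d))"
    by blast
qed

lemma parabolic_graph_iso_imp:
  assumes "graph_iso G H" "simple_graph H" "parabolic_graph d G"
  shows "parabolic_graph d H"
  unfolding parabolic_graph_def
proof
  from assms obtain f where f: "graph_iso_map f G H" unfolding graph_iso_def by blast
  fix w assume "w \<in> verts H"
  then have "w \<in> f ` verts G"
    using f by (simp add: graph_iso_map_def bij_betw_def)
  then obtain v where v: "v \<in> verts G" "w = f v" by blast
  then show "VEL d H w = \<infinity>"
    using VEL_iso_le[OF f assms(2) v(1), of d] assms(3)
    by (simp add: parabolic_graph_def top_unique)
qed

lemma parabolic_graph_iso:
  assumes "graph_iso G H" "simple_graph G" "simple_graph H"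
  shows "parabolic_graph d G \<longleftrightarrow> parabolic_graph d H"
  by (rule iffI) (erule parabolic_graph_iso_imp[OF assms(1,3)],
    erule parabolic_graph_iso_imp[OF graph_iso_sym[OF assms(1)] assms(2)])

section \<open>The space of rooted graphs with the local metric\<close>

definition iso_depths :: "'v ugraph \<times> 'v \<Rightarrow> 'u ugraph \<times> 'u \<Rightarrow> nat set" where
  "iso_depths p q = {k. rooted_iso (rooted_ball p k) (rooted_ball q k)}"

definition local_dist :: "'v ugraph \<times> 'v \<Rightarrow> 'u ugraph \<times> 'u \<Rightarrow> real" where
  "local_dist p q =
     (if bdd_above (iso_depths p q) then inverse (1 + real (Sup (iso_depths p q))) else 0)"

lemma graph_dist_walk:
  assumes "is_rooted_graph p" "v \<in> verts (fst p)"
  shows "(snd p, v) \<in> adj_rel (fst p) ^^ graph_dist (fst p) (snd p) v"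
proof -
  have "(snd p, v) \<in> (adj_rel (fst p))\<^sup>*"
    using assms by (auto simp: is_rooted_graph_def connected_graph_def)
  then obtain n where "(snd p, v) \<in> adj_rel (fst p) ^^ n"
    using rtrancl_imp_relpow by blast
  then show ?thesis unfolding graph_dist_def by (rule LeastI)
qed

lemma ball_verts_0:
  assumes "is_rooted_graph p"
  shows "ball_verts (fst p) (snd p) 0 = {snd p}"
proof -
  have "graph_dist (fst p) (snd p) (snd p) = 0"
    unfolding graph_dist_def by (rule Least_eq_0) simp
  moreover have "v = snd p" if "v \<in> verts (fst p)" "graph_dist (fst p) (snd p) v = 0" for v
    using graph_dist_walk[OF assms that(1)] that(2) by simp
  ultimately show ?thesis using assms by (auto simp: ball_verts_def is_rooted_graph_def)
qed

lemma ball_verts_Suc: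
  assumes p: "is_rooted_graph p"
  shows "ball_verts (fst p) (snd p) (Suc k) = ball_verts (fst p) (snd p) k \<union>
     {v. \<exists>u\<in>ball_verts (fst p) (snd p) k. {u, v} \<in> edges (fst p)}"
    (is "?L = ?A \<union> ?B")
proof (intro equalityI subsetI)
  fix v assume v: "v \<in> ?L"
  show "v \<in> ?A \<union> ?B"
  proof (cases "graph_dist (fst p) (snd p) v \<le> k")
    case True then show ?thesis using v by (simp add: ball_verts_def)
  next
    case False
    with v have d: "graph_dist (fst p) (snd p) v = Suc k" "v \<in> verts (fst p)"
      by (auto simp: ball_verts_def)
    from graph_dist_walk[OF p d(2)] obtain u where
      u: "(snd p, u) \<in> adj_rel (fst p) ^^ k" "{u, v} \<in> edges (fst p)"
      by (auto simp: d adj_rel_def)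
    have "graph_dist (fst p) (snd p) u \<le> k"
      unfolding graph_dist_def using u(1) by (rule Least_le)
    then have "u \<in> ?A"
      using simple_graph_edgeD(1)[OF _ u(2)] p by (simp add: ball_verts_def is_rooted_graph_def)
    with u show ?thesis by blast
  qed
next
  fix v assume "v \<in> ?A \<union> ?B"
  then show "v \<in> ?L"
  proof
    assume "v \<in> ?A" then show ?thesis by (auto simp: ball_verts_def)
  next
    assume "v \<in> ?B"
    then obtain u where u: "u \<in> ?A" "{u, v} \<in> edges (fst p)" by blast
    then have "(snd p, v) \<in> adj_rel (fst p) ^^ Suc (graph_dist (fst p) (snd p) u)"
      using graph_dist_walk[OF p, of u] by (auto simp: ball_verts_def adj_rel_def)
    then have "graph_dist (fst p) (snd p) v \<le> Suc (graph_dist (fst p) (snd p) u)"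
      unfolding graph_dist_def[of _ _ v] by (rule Least_le)
    then show ?thesis
      using u simple_graph_edgeD(2)[OF _ u(2)] p
      by (simp add: ball_verts_def is_rooted_graph_def)
  qed
qed

lemma ball_verts_mono: "j \<le> k \<Longrightarrow> ball_verts G x j \<subseteq> ball_verts G x k"
  by (auto simp: ball_verts_def)

lemma root_in_ball: "is_rooted_graph p \<Longrightarrow> snd p \<in> ball_verts (fst p) (snd p) k"
  using ball_verts_0[of p] ball_verts_mono[of 0 k "fst p" "snd p"] by auto

lemma finite_ball_verts:
  assumes p: "is_rooted_graph p"
  shows "finite (ball_verts (fst p) (snd p) k)"
proof (induction k)
  case 0 then show ?case using ball_verts_0[OF p] by simp
next
  case (Suc k)
  have "{v. \<exists>u\<in>ball_verts (fst p) (snd p) k. {u, v} \<in> edges (fst p)} =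
     (\<Union>u\<in>ball_verts (fst p) (snd p) k. {v. {u, v} \<in> edges (fst p)})" by auto
  moreover have "finite {v. {u, v} \<in> edges (fst p)}" if "u \<in> ball_verts (fst p) (snd p) k" for u
    using p that by (auto simp: is_rooted_graph_def locally_finite_graph_def ball_verts_def)
  ultimately show ?case using Suc ball_verts_Suc[OF p] by auto
qed

definition ball_iso_map ::
  "('v \<Rightarrow> 'u) \<Rightarrow> 'v ugraph \<times> 'v \<Rightarrow> 'u ugraph \<times> 'u \<Rightarrow> nat \<Rightarrow> bool" where
  "ball_iso_map f p q k \<longleftrightarrow>
     graph_iso_map f (fst (rooted_ball p k)) (fst (rooted_ball q k)) \<and> f (snd p) = snd q"

lemma iso_depths_iff: "k \<in> iso_depths p q \<longleftrightarrow> (\<exists>f. ball_iso_map f p q k)"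
  by (simp add: iso_depths_def rooted_iso_def ball_iso_map_def rooted_ball_def)

lemma ball_iso_map_iff:
  fixes f :: "'v \<Rightarrow> 'u"
  shows "ball_iso_map f p q k \<longleftrightarrow>
     bij_betw f (ball_verts (fst p) (snd p) k) (ball_verts (fst q) (snd q) k) \<and>
     (\<forall>u\<in>ball_verts (fst p) (snd p) k. \<forall>v\<in>ball_verts (fst p) (snd p) k.
        {u, v} \<in> edges (fst p) \<longleftrightarrow> {f u, f v} \<in> edges (fst q)) \<and> f (snd p) = snd q"
proof -
  let ?A = "ball_verts (fst p) (snd p) k" and ?B = "ball_verts (fst q) (snd q) k"
  have *: "verts G \<inter> ball_verts G x k = ball_verts G x k" for G :: "'v ugraph" and x
    by (auto simp: ball_verts_def)
  have **: "verts G \<inter> ball_verts G x k = ball_verts G x k" for G :: "'u ugraph" and x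
    by (auto simp: ball_verts_def)
  have "u \<in> ?A \<Longrightarrow> f u \<in> ?B" if "bij_betw f ?A ?B" for u
    using that by (rule bij_betwE[THEN bspec])
  then show ?thesis
    unfolding ball_iso_map_def graph_iso_map_def rooted_ball_def induced_subgraph_def
    by (auto simp: * **)
qed

lemma ball_iso_map_image_sub:
  assumes p: "is_rooted_graph p" and q: "is_rooted_graph q"
    and f: "ball_iso_map f p q k" and "j \<le> k"
  shows "f ` ball_verts (fst p) (snd p) j \<subseteq> ball_verts (fst q) (snd q) j"
  using \<open>j \<le> k\<close>
proof (induction j)
  case 0 then show ?case using f by (simp add: ball_verts_0 p q ball_iso_map_iff)
next
  case (Suc j)
  then have IH: "f ` ball_verts (fst p) (snd p) j \<subseteq> ball_verts (fst q) (snd q) j" by simp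
  show ?case
  proof (rule image_subsetI)
    fix v assume v: "v \<in> ball_verts (fst p) (snd p) (Suc j)"
    then consider "v \<in> ball_verts (fst p) (snd p) j"
      | u where "u \<in> ball_verts (fst p) (snd p) j" "{u, v} \<in> edges (fst p)"
      using ball_verts_Suc[OF p] by blast
    then show "f v \<in> ball_verts (fst q) (snd q) (Suc j)"
    proof cases
      case 1 then show ?thesis using IH ball_verts_Suc[OF q] by blast
    next
      case 2
      have "u \<in> ball_verts (fst p) (snd p) k" "v \<in> ball_verts (fst p) (snd p) k"
        using 2 v Suc.prems ball_verts_mono[of _ k "fst p" "snd p"]
        by (meson Suc_leD in_mono)+
      then have "{f u, f v} \<in> edges (fst q)" using f 2 by (simp add: ball_iso_map_iff)
      then show ?thesis using IH 2 ball_verts_Suc[OF q] by blast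
    qed
  qed
qed

lemma ball_iso_map_inv:
  assumes p: "is_rooted_graph p" and f: "ball_iso_map f p q k"
  shows "ball_iso_map (inv_into (ball_verts (fst p) (snd p) k) f) q p k"
proof -
  have v: "verts (fst (rooted_ball p k)) = ball_verts (fst p) (snd p) k"
    by (auto simp: rooted_ball_def induced_subgraph_def ball_verts_def)
  have "inv_into (ball_verts (fst p) (snd p) k) f (snd q) = snd p"
    using f root_in_ball[OF p] by (auto simp: ball_iso_map_iff bij_betw_def intro: inv_into_f_eq)
  then show ?thesis
    using f graph_iso_map_inv[of f "fst (rooted_ball p k)" "fst (rooted_ball q k)"]
    by (simp add: ball_iso_map_def v)
qed

lemma ball_iso_map_image:
  assumes p: "is_rooted_graph p" and q: "is_rooted_graph q"
    and f: "ball_iso_map f p q k" and jk: "j \<le> k"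
  shows "f ` ball_verts (fst p) (snd p) j = ball_verts (fst q) (snd q) j"
proof
  show "f ` ball_verts (fst p) (snd p) j \<subseteq> ball_verts (fst q) (snd q) j"
    by (rule ball_iso_map_image_sub[OF assms])
  let ?g = "inv_into (ball_verts (fst p) (snd p) k) f"
  have g: "?g ` ball_verts (fst q) (snd q) j \<subseteq> ball_verts (fst p) (snd p) j"
    by (rule ball_iso_map_image_sub[OF q p ball_iso_map_inv[OF p f] jk])
  show "ball_verts (fst q) (snd q) j \<subseteq> f ` ball_verts (fst p) (snd p) j"
  proof
    fix w assume w: "w \<in> ball_verts (fst q) (snd q) j"
    then have "w \<in> ball_verts (fst q) (snd q) k"
      using ball_verts_mono[OF jk, of "fst q" "snd q"] by blast
    then have "f (?g w) = w" using f by (auto simp: ball_iso_map_iff bij_betw_def f_inv_into_f)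
    with w g show "w \<in> f ` ball_verts (fst p) (snd p) j" by (metis image_eqI image_subset_iff)
  qed
qed

lemma ball_iso_map_le:
  assumes p: "is_rooted_graph p" and q: "is_rooted_graph q"
    and f: "ball_iso_map f p q k" and jk: "j \<le> k"
  shows "ball_iso_map f p q j"
proof -
  note sub = ball_verts_mono[OF jk, of "fst p" "snd p"]
  have "inj_on f (ball_verts (fst p) (snd p) j)"
    using f sub by (auto simp: ball_iso_map_iff bij_betw_def intro: inj_on_subset)
  then show ?thesis
    using f subsetD[OF sub] ball_iso_map_image[OF assms] by (simp add: ball_iso_map_iff bij_betw_def)
qed

lemma iso_depths_down:
  assumes "is_rooted_graph p" "is_rooted_graph q" "k \<in> iso_depths p q" "j \<le> k"
  shows "j \<in> iso_depths p q"
proof -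
  from assms(3) obtain f where "ball_iso_map f p q k" unfolding iso_depths_iff ..
  from ball_iso_map_le[OF assms(1,2) this assms(4)] show ?thesis
    unfolding iso_depths_iff by (intro exI)
qed

lemma zero_in_iso_depths:
  assumes "is_rooted_graph p" "is_rooted_graph q"
  shows "0 \<in> iso_depths p q"
proof -
  have "ball_iso_map (\<lambda>_. snd q) p q 0"
    using assms by (auto simp: ball_iso_map_iff ball_verts_0 bij_betw_def is_rooted_graph_def
        simple_graph_no_loop)
  then show ?thesis unfolding iso_depths_iff by blast
qed

lemma iso_depths_sym:
  assumes "is_rooted_graph p" "is_rooted_graph q"
  shows "iso_depths p q = iso_depths q p"
proof (intro equalityI subsetI)
  fix k
  show "k \<in> iso_depths q p" if "k \<in> iso_depths p q"
  proof -
    from that obtain f where "ball_iso_map f p q k" unfolding iso_depths_iff ..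
    from ball_iso_map_inv[OF assms(1) this] show ?thesis
      unfolding iso_depths_iff by (intro exI)
  qed
  show "k \<in> iso_depths p q" if "k \<in> iso_depths q p"
  proof -
    from that obtain f where "ball_iso_map f q p k" unfolding iso_depths_iff ..
    from ball_iso_map_inv[OF assms(2) this] show ?thesis
      unfolding iso_depths_iff by (intro exI)
  qed
qed

lemma iso_depths_trans:
  "k \<in> iso_depths p q \<Longrightarrow> k \<in> iso_depths q s \<Longrightarrow> k \<in> iso_depths p s"
  unfolding iso_depths_def using rooted_iso_trans by blast

lemma rooted_iso_imp_iso_depths:
  assumes p: "is_rooted_graph p" and q: "is_rooted_graph q" and "rooted_iso p q"
  shows "k \<in> iso_depths p q"
proof -
  from assms obtain f where f: "graph_iso_map f (fst p) (fst q)" "f (snd p) = snd q"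
    unfolding rooted_iso_def by blast
  have im: "f ` ball_verts (fst p) (snd p) j = ball_verts (fst q) (snd q) j" for j
  proof (induction j)
    case 0 then show ?case using f by (simp add: ball_verts_0 p q)
  next
    case (Suc j)
    have "f ` {v. \<exists>u\<in>ball_verts (fst p) (snd p) j. {u, v} \<in> edges (fst p)} =
        {v. \<exists>u\<in>ball_verts (fst q) (snd q) j. {u, v} \<in> edges (fst q)}" (is "f ` ?A = ?B")
    proof (intro equalityI subsetI)
      fix w assume "w \<in> f ` ?A"
      then obtain u v where uv: "u \<in> ball_verts (fst p) (snd p) j" "{u, v} \<in> edges (fst p)" "w = f v"
        by blast
      then have "{f u, f v} \<in> edges (fst q)"
        using f(1) simple_graph_edgeD[OF _ uv(2)] p
        by (simp add: graph_iso_map_def is_rooted_graph_def)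
      moreover have "f u \<in> ball_verts (fst q) (snd q) j" using uv(1) Suc by blast
      ultimately show "w \<in> ?B" using uv(3) by blast
    next
      fix w assume "w \<in> ?B"
      then obtain u' where u': "u' \<in> f ` ball_verts (fst p) (snd p) j" "{u', w} \<in> edges (fst q)"
        unfolding Suc by blast
      then obtain u where u: "u \<in> ball_verts (fst p) (snd p) j" "{f u, w} \<in> edges (fst q)"
        by blast
      then have "w \<in> verts (fst q)"
        using simple_graph_edgeD(2)[OF _ u(2)] q by (simp add: is_rooted_graph_def)
      then have "w \<in> f ` verts (fst p)"
        using f by (simp add: graph_iso_map_def bij_betw_def)
      then obtain v where v: "v \<in> verts (fst p)" "w = f v" by blast
      then have "{u, v} \<in> edges (fst p)"
        using f(1) u by (simp add: graph_iso_map_def ball_verts_def)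
      then show "w \<in> f ` ?A" using u v by blast
    qed
    then show ?case using Suc by (simp add: ball_verts_Suc p q image_Un)
  qed
  have "inj_on f (ball_verts (fst p) (snd p) k)"
    using f by (auto simp: graph_iso_map_def bij_betw_def ball_verts_def intro: inj_on_subset)
  then have "ball_iso_map f p q k"
    using f im by (auto simp: ball_iso_map_iff bij_betw_def graph_iso_map_def ball_verts_def)
  then show ?thesis unfolding iso_depths_iff by blast
qed

lemma iso_depths_cong:
  assumes "is_rooted_graph p" "is_rooted_graph p'" "rooted_iso p p'"
    "is_rooted_graph q" "is_rooted_graph q'" "rooted_iso q q'"
  shows "iso_depths p q = iso_depths p' q'"
proof -
  have a: "k \<in> iso_depths p p'" "k \<in> iso_depths q q'" for k
    using assms by (auto intro: rooted_iso_imp_iso_depths)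
  have b: "k \<in> iso_depths p' p" "k \<in> iso_depths q' q" for k
    using a iso_depths_sym assms by metis+
  show ?thesis
  proof (intro equalityI subsetI)
    fix k assume "k \<in> iso_depths p q"
    from iso_depths_trans[OF iso_depths_trans[OF b(1) this] a(2)] show "k \<in> iso_depths p' q'" .
  next
    fix k assume "k \<in> iso_depths p' q'"
    from iso_depths_trans[OF iso_depths_trans[OF a(1) this] b(2)] show "k \<in> iso_depths p q" .
  qed
qed

text \<open>
  Compactness (Koenig): if all balls are isomorphic, then so are the rooted graphs.
\<close>

lemma iso_depths_UNIV_imp_iso:
  fixes p :: "nat ugraph \<times> nat" and q :: "nat ugraph \<times> nat"
  assumes p: "is_rooted_graph p" and q: "is_rooted_graph q"
    and all: "\<And>k. k \<in> iso_depths p q"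
  shows "rooted_iso p q"
proof -
  let ?B = "ball_verts (fst p) (snd p)" and ?C = "ball_verts (fst q) (snd q)"
  from all have "\<forall>k. \<exists>f. ball_iso_map f p q k" by (simp add: iso_depths_iff)
  then obtain F where F: "\<And>k. ball_iso_map (F k) p q k" by metis
  have pigeon: "\<exists>B. infinite B \<and> B \<subseteq> A \<and> (v \<in> verts (fst p) \<longrightarrow> (\<exists>w. \<forall>k\<in>B. F k v = w))"
    if A: "infinite A" for A :: "nat set" and v
  proof (cases "v \<in> verts (fst p)")
    case False then show ?thesis using A by blast
  next
    case True
    define j where "j = graph_dist (fst p) (snd p) v"
    have vj: "v \<in> ?B j" using True by (simp add: j_def ball_verts_def)
    define A' where "A' = A \<inter> {j..}"
    have A': "infinite A'"
    proof
      assume "finite A'"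
      moreover have "A \<subseteq> A' \<union> {..<j}" by (auto simp: A'_def)
      ultimately show False using A finite_subset by blast
    qed
    have "(\<lambda>k. F k v) ` A' \<subseteq> ?C j"
      using ball_iso_map_image[OF p q F, of j] vj by (auto simp: A'_def)
    then have "finite ((\<lambda>k. F k v) ` A')" using finite_ball_verts[OF q] finite_subset by blast
    from pigeonhole_infinite[OF A' this] obtain a where
      "infinite {k\<in>A'. F k v = F a v}" by blast
    then show ?thesis by (intro exI[of _ "{k\<in>A'. F k v = F a v}"]) (auto simp: A'_def)
  qed
  have "\<exists>S. \<forall>n. infinite (S n) \<and>
     (S (Suc n) \<subseteq> S n \<and> (n \<in> verts (fst p) \<longrightarrow> (\<exists>w. \<forall>k\<in>S (Suc n). F k n = w)))"
  proof (rule dependent_nat_choice[where P = "\<lambda>_ S. infinite S"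
        and Q = "\<lambda>n S T. T \<subseteq> S \<and> (n \<in> verts (fst p) \<longrightarrow> (\<exists>w. \<forall>k\<in>T. F k n = w))"])
    show "\<exists>x::nat set. infinite x" using infinite_UNIV_nat by blast
    show "\<exists>T. infinite T \<and> T \<subseteq> S \<and> (n \<in> verts (fst p) \<longrightarrow> (\<exists>w. \<forall>k\<in>T. F k n = w))"
      if "infinite S" for S n using pigeon[OF that, of n] .
  qed
  then obtain S where S: "\<And>n. infinite (S n)" "\<And>n. S (Suc n) \<subseteq> S n"
    "\<And>n. n \<in> verts (fst p) \<Longrightarrow> \<exists>w. \<forall>k\<in>S (Suc n). F k n = w" by blast
  have "\<exists>f. \<forall>n\<in>verts (fst p). \<forall>k\<in>S (Suc n). F k n = f n"
    using S(3) by (intro bchoice ballI)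
  then obtain f where f: "\<And>n k. n \<in> verts (fst p) \<Longrightarrow> k \<in> S (Suc n) \<Longrightarrow> F k n = f n" by blast
  have S_anti: "S n \<subseteq> S m" if "m \<le> n" for m n
    using that by (induction rule: dec_induct) (use S(2) in blast)+
  have agree: "\<exists>k\<ge>j. \<forall>v\<in>X. F k v = f v" if X: "finite X" "X \<subseteq> verts (fst p)" for j X
  proof -
    obtain N where N: "\<And>v. v \<in> X \<Longrightarrow> v \<le> N" using X(1)
      unfolding finite_nat_set_iff_bounded_le by blast
    obtain k where k: "k \<ge> j" "k \<in> S (Suc N)"
      using S(1)[of "Suc N"] by (meson infinite_nat_iff_unbounded_le)
    have "F k v = f v" if "v \<in> X" for v
      using f[of v k] X(2) that N[OF that] S_anti[of "Suc v" "Suc N"] k(2) by auto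
    with k(1) show ?thesis by blast
  qed
  have ball: "\<exists>k\<ge>j. \<forall>v\<in>?B j. F k v = f v" for j
    using agree[of "?B j" j] finite_ball_verts[OF p] by (auto simp: ball_verts_def)
  have fball: "ball_iso_map f p q j" for j
  proof -
    obtain k where k: "k \<ge> j" "\<And>v. v \<in> ?B j \<Longrightarrow> F k v = f v" using ball[of j] by blast
    have Fk: "ball_iso_map (F k) p q j" using ball_iso_map_le[OF p q F k(1)] .
    then have "bij_betw f (?B j) (?C j)" using k(2) by (simp add: ball_iso_map_iff cong: bij_betw_cong)
    then show ?thesis using Fk k(2) root_in_ball[OF p, of j] by (simp add: ball_iso_map_iff)
  qed
  have two: "\<exists>j. u \<in> ?B j \<and> v \<in> ?B j" if "u \<in> verts (fst p)" "v \<in> verts (fst p)" for u v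
    using that by (intro exI[of _ "max (graph_dist (fst p) (snd p) u) (graph_dist (fst p) (snd p) v)"])
      (auto simp: ball_verts_def)
  have "graph_iso_map f (fst p) (fst q)"
    unfolding graph_iso_map_def bij_betw_def
  proof (intro conjI ballI inj_onI)
    fix u v assume uv: "u \<in> verts (fst p)" "v \<in> verts (fst p)"
    then obtain j where j: "u \<in> ?B j" "v \<in> ?B j" using two by blast
    show "{u, v} \<in> edges (fst p) \<longleftrightarrow> {f u, f v} \<in> edges (fst q)"
      using fball[of j] j by (simp add: ball_iso_map_iff)
    show "u = v" if "f u = f v"
      using fball[of j] j that by (auto simp: ball_iso_map_iff bij_betw_def dest: inj_onD)
  next
    show "f ` verts (fst p) = verts (fst q)"
    proof (intro equalityI subsetI)
      fix w assume "w \<in> f ` verts (fst p)"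
      then obtain v where v: "v \<in> verts (fst p)" "w = f v" by blast
      then obtain j where "v \<in> ?B j" using two by blast
      then have "w \<in> ?C j" using fball[of j] v by (auto simp: ball_iso_map_iff bij_betw_def)
      then show "w \<in> verts (fst q)" by (simp add: ball_verts_def)
    next
      fix w assume "w \<in> verts (fst q)"
      then have "w \<in> ?C (graph_dist (fst q) (snd q) w)" by (simp add: ball_verts_def)
      then have "w \<in> f ` ?B (graph_dist (fst q) (snd q) w)"
        using fball by (auto simp: ball_iso_map_iff bij_betw_def)
      then show "w \<in> f ` verts (fst p)" by (auto simp: ball_verts_def)
    qed
  qed
  moreover have "f (snd p) = snd q" using fball[of 0] by (simp add: ball_iso_map_iff)
  ultimately show ?thesis unfolding rooted_iso_def by blast
qed

lemma local_dist_antimono: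
  assumes "iso_depths p q \<subseteq> iso_depths p' q'" "iso_depths p q \<noteq> {}"
  shows "local_dist p' q' \<le> local_dist p q"
proof (cases "bdd_above (iso_depths p' q')")
  case True
  then have "bdd_above (iso_depths p q)" using assms(1) by (rule bdd_above_mono)
  moreover have "Sup (iso_depths p q) \<le> Sup (iso_depths p' q')"
    using assms True by (intro cSup_subset_mono)
  ultimately show ?thesis using True by (simp add: local_dist_def le_imp_inverse_le)
next
  case False then show ?thesis by (simp add: local_dist_def)
qed

lemma local_dist_cong:
  assumes "is_rooted_graph p" "is_rooted_graph p'" "rooted_iso p p'"
    "is_rooted_graph q" "is_rooted_graph q'" "rooted_iso q q'"
  shows "local_dist p q = local_dist p' q'"
  unfolding local_dist_def iso_depths_cong[OF assms] ..

lemma local_dist_sym: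
  assumes "is_rooted_graph p" "is_rooted_graph q"
  shows "local_dist p q = local_dist q p"
  unfolding local_dist_def iso_depths_sym[OF assms] ..

lemma local_dist_nonneg: "0 \<le> local_dist p q"
  by (simp add: local_dist_def)

lemma local_dist_triangle:
  assumes p: "is_rooted_graph p" and q: "is_rooted_graph q" and s: "is_rooted_graph s"
  shows "local_dist p s \<le> local_dist p q + local_dist q s"
proof -
  have ne: "iso_depths p q \<noteq> {}" "iso_depths q s \<noteq> {}" using zero_in_iso_depths p q s by blast+
  have "iso_depths p q \<subseteq> iso_depths q s \<or> iso_depths q s \<subseteq> iso_depths p q"
    using iso_depths_down[OF p q] iso_depths_down[OF q s] by (meson nat_le_linear subsetI)
  then have "iso_depths p q \<subseteq> iso_depths p s \<or> iso_depths q s \<subseteq> iso_depths p s"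
    using iso_depths_trans by blast
  then have "local_dist p s \<le> local_dist p q \<or> local_dist p s \<le> local_dist q s"
    using local_dist_antimono[OF _ ne(1), of p s] local_dist_antimono[OF _ ne(2), of p s] by iprover
  then show ?thesis using local_dist_nonneg[of p q] local_dist_nonneg[of q s] by linarith
qed

lemma local_dist_eq_0_iff:
  fixes p :: "nat ugraph \<times> nat" and q :: "nat ugraph \<times> nat"
  assumes p: "is_rooted_graph p" and q: "is_rooted_graph q"
  shows "local_dist p q = 0 \<longleftrightarrow> rooted_iso p q"
proof
  assume "local_dist p q = 0"
  then have nb: "\<not> bdd_above (iso_depths p q)" by (auto simp: local_dist_def split: if_splits)
  have "k \<in> iso_depths p q" for k
  proof -
    obtain j where "j \<in> iso_depths p q" "k \<le> j"
      using nb unfolding bdd_above_def by (meson nat_le_linear)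
    then show ?thesis using iso_depths_down[OF p q] by blast
  qed
  then show "rooted_iso p q" using iso_depths_UNIV_imp_iso[OF p q] by blast
next
  assume "rooted_iso p q"
  then have "iso_depths p q = UNIV" using rooted_iso_imp_iso_depths[OF p q] by blast
  then show "local_dist p q = 0" by (simp add: local_dist_def bdd_above_nat)
qed

text \<open>
  Locally finite connected graphs are countable, so every isomorphism class has a
  representative whose vertices are natural numbers.
\<close>

definition rooted_rel :: "nat ugraph \<times> nat \<Rightarrow> nat ugraph \<times> nat \<Rightarrow> bool" where
  "rooted_rel p q \<longleftrightarrow> is_rooted_graph p \<and> is_rooted_graph q \<and> rooted_iso p q"

lemma part_equivp_rooted_rel: "part_equivp rooted_rel"
proof (rule part_equivpI)
  have "is_rooted_graph (\<lparr>verts = {0}, edges = {}\<rparr>, 0 :: nat)"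
    by (simp add: is_rooted_graph_def simple_graph_def locally_finite_graph_def connected_graph_def)
  then show "\<exists>x. rooted_rel x x" using rooted_iso_refl unfolding rooted_rel_def by blast
  show "symp rooted_rel"
    by (rule sympI) (auto simp: rooted_rel_def is_rooted_graph_def intro: rooted_iso_sym)
  show "transp rooted_rel"
    by (rule transpI) (auto simp: rooted_rel_def intro: rooted_iso_trans)
qed

quotient_type rooted_graph = "nat ugraph \<times> nat" / partial: rooted_rel
  by (rule part_equivp_rooted_rel)

instantiation rooted_graph :: metric_space
begin

lift_definition dist_rooted_graph :: "rooted_graph \<Rightarrow> rooted_graph \<Rightarrow> real" is local_dist
  unfolding rooted_rel_def by (rule local_dist_cong) auto

definition uniformity_rooted_graph :: "(rooted_graph \<times> rooted_graph) filter" where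
  "uniformity_rooted_graph = (INF e\<in>{0<..}. principal {(x, y). dist x y < e})"

definition open_rooted_graph :: "rooted_graph set \<Rightarrow> bool" where
  "open_rooted_graph U \<longleftrightarrow> (\<forall>x\<in>U. \<forall>\<^sub>F (x', y) in uniformity. x' = x \<longrightarrow> y \<in> U)"

instance
proof
  fix x y z :: rooted_graph
  show "dist x y = 0 \<longleftrightarrow> x = y"
    by transfer (auto simp: rooted_rel_def local_dist_eq_0_iff)
  show "dist x y \<le> dist x z + dist y z"
    by transfer (metis rooted_rel_def local_dist_sym local_dist_triangle)
qed (simp_all add: uniformity_rooted_graph_def open_rooted_graph_def)

end

text \<open>The isomorphism class of \<open>(G, v)\<close>.\<close>

definition rooted_class :: "nat ugraph \<Rightarrow> nat \<Rightarrow> rooted_graph" where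
  "rooted_class G v = abs_rooted_graph (G, v)"

lift_definition has_graph :: "rooted_graph \<Rightarrow> nat ugraph \<Rightarrow> bool" is
  "\<lambda>p H. graph_iso (fst p) H"
  by (rule ext, rule graph_iso_cong) (simp add: rooted_rel_def rooted_iso_imp_iso)

lift_definition finite_rooted_graph :: "rooted_graph \<Rightarrow> bool" is "\<lambda>p. finite (verts (fst p))"
  by (rule graph_iso_finite) (simp add: rooted_rel_def rooted_iso_imp_iso)

lift_definition uniform_rooted_graph ::
    "'a::euclidean_space itself \<Rightarrow> real \<Rightarrow> rooted_graph \<Rightarrow> bool" is
  "\<lambda>T M p. uniform_graph T M (fst p)"
  by (rule uniform_graph_iso) (simp add: rooted_rel_def rooted_iso_imp_iso)

lift_definition parabolic_rooted_graph :: "nat \<Rightarrow> rooted_graph \<Rightarrow> bool" is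
  "\<lambda>d p. parabolic_graph d (fst p)"
  by (rule parabolic_graph_iso) (simp_all add: rooted_rel_def is_rooted_graph_def rooted_iso_imp_iso)

section \<open>Random rooted graphs\<close>

text \<open>
  Up to isomorphism there are only countably many finite graphs, so conditioning on the
  unrooted graph is elementary conditioning on the events \<open>{G \<cong> H}\<close> of positive probability.
  The right-hand side is the law of \<open>(H, U)\<close> with \<open>U\<close> uniform on \<open>verts H\<close>.
\<close>

definition unbiased :: "'w measure \<Rightarrow> ('w \<Rightarrow> rooted_graph) \<Rightarrow> bool" where
  "unbiased \<Omega> X \<longleftrightarrow>
     X \<in> borel_measurable \<Omega> \<and>
     (AE \<omega> in \<Omega>. finite_rooted_graph (X \<omega>)) \<and>
     (\<forall>H. simple_graph H \<and> connected_graph H \<and> finite (verts H) \<and> verts H \<noteq> {} \<and>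
          \<P>(\<omega> in \<Omega>. has_graph (X \<omega>) H) > 0 \<longrightarrow>
        (\<forall>A\<in>sets borel. \<P>(\<omega> in \<Omega>. X \<omega> \<in> A \<bar> has_graph (X \<omega>) H) =
           measure_pmf.prob (pmf_of_set (verts H)) {v. rooted_class H v \<in> A}))"

definition weakly_converges ::
    "(nat \<Rightarrow> 'a::topological_space measure) \<Rightarrow> 'a measure \<Rightarrow> bool" where
  "weakly_converges \<mu> \<nu> \<longleftrightarrow>
     (\<forall>f \<in> (bcontfun :: ('a \<Rightarrow> real) set). (\<lambda>n. \<integral>x. f x \<partial>\<mu> n) \<longlonglongrightarrow> (\<integral>x. f x \<partial>\<nu>))"

end

theory Submission
  imports Defs "HOL-Real_Asymp.Real_Asymp"
begin

text \<open>
  The proof is local and quantitative and avoids limits of packings. Call a rooted graph cheap at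
  level \<open>(\<epsilon>, R)\<close> if some weight \<open>m\<close> on the ball of radius \<open>R\<close> has \<open>\<Sum>m ^ d \<le> \<epsilon>\<close> and gives length at
  least \<open>1\<close> to every simple path with \<open>R\<close> edges from the root. Being cheap depends only on a finite
  ball, hence is a clopen condition, and if a rooted graph is cheap at some level \<open>(\<epsilon>, R)\<close> for every
  \<open>\<epsilon>\<close>, then it is \<open>d\<close>-parabolic. So it is enough to see that, for suitable \<open>R\<close> depending only
  on \<open>\<epsilon>, \<delta>, M, d\<close>, all but a fraction \<open>\<delta>\<close> of the vertices of a finite \<open>M\<close>-uniform graph are cheap.

  By the magic lemma of Benjamini and Schramm, seen from most vertices \<open>v\<close>, all but boundedly many of the
  centres within distance \<open>2 ^ n * r v\<close> lie within \<open>r v / 2 ^ n\<close> of a single centre \<open>q\<close>. A long simple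
  path from such a \<open>v\<close> then crosses \<open>n\<close> dyadic annuli around \<open>v\<close> or around \<open>q\<close>. The weights
  \<open>r u / dist (c v) (c u)\<close> and \<open>r u / dist (c q) (c u)\<close> give such a crossing length of order \<open>n\<close>, while
  disjointness of the balls bounds the sum of their \<open>d\<close>-th powers by \<open>O(n)\<close>; after division by \<open>n\<close> that
  sum is \<open>O(n powr (1 - d))\<close>, which tends to \<open>0\<close> because \<open>d \<ge> 2\<close>.
\<close>

section \<open>Disjoint balls\<close>

text \<open>If the centres were closer than \<open>a + b\<close>, the point dividing the segment
  from \<open>x\<close> to \<open>y\<close> in the ratio \<open>a : b\<close> would lie in both open
  balls.\<close>

lemma dist_ge_of_disjoint_interiors:
  fixes x y :: "'a::euclidean_space"
  assumes "interior (cball x a) \<inter> interior (cball y b) = {}" "0 < a" "0 < b"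
  shows "a + b \<le> dist x y"
proof (rule ccontr)
  assume "\<not> ?thesis"
  then have lt: "dist x y < a + b" by simp
  define s where "s = a / (a + b)"
  define z where "z = x + s *\<^sub>R (y - x)"
  have s: "0 \<le> s" "1 - s = b / (a + b)"
    using assms by (auto simp: s_def field_simps)
  have "dist x z = s * dist x y"
    using s by (simp add: z_def dist_norm norm_minus_commute)
  also have "\<dots> < a"
    using mult_strict_left_mono[OF lt assms(2)] assms(2,3) by (simp add: s_def pos_divide_less_eq)
  finally have 1: "z \<in> ball x a" by simp
  have "y - z = (1 - s) *\<^sub>R (y - x)" by (simp add: z_def algebra_simps)
  then have "dist y z = (1 - s) * dist x y"
    using s(2) assms(2,3) by (simp add: dist_norm norm_minus_commute)
  also have "\<dots> < b"
    using mult_strict_left_mono[OF lt assms(3)] assms(2,3) by (simp add: s(2) pos_divide_less_eq)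
  finally have "z \<in> ball y b" by simp
  with 1 assms(1) show False by (auto simp: interior_cball)
qed

text \<open>Volume comparison: the open balls are disjoint and lie in \<open>cball x R\<close>, and
  the volume of the unit ball cancels.\<close>

lemma sum_radii_power_le:
  fixes c :: "'v \<Rightarrow> 'a::euclidean_space"
  assumes I: "finite I" and r: "\<And>u. u \<in> I \<Longrightarrow> 0 < r u"
    and sep: "\<And>u v. u \<in> I \<Longrightarrow> v \<in> I \<Longrightarrow> u \<noteq> v \<Longrightarrow> r u + r v \<le> dist (c u) (c v)"
    and R: "\<And>u. u \<in> I \<Longrightarrow> dist x (c u) + r u \<le> R" "0 \<le> R"
  shows "(\<Sum>u\<in>I. r u ^ DIM('a)) \<le> R ^ DIM('a)"
proof -
  have disj: "disjoint_family_on (\<lambda>u. ball (c u) (r u)) I"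
    unfolding disjoint_family_on_def
  proof (intro ballI impI)
    fix u v assume uv: "u \<in> I" "v \<in> I" "u \<noteq> v"
    have "False" if z: "dist (c u) z < r u" "dist (c v) z < r v" for z
      using dist_triangle2[of "c u" "c v" z] sep[OF uv] z by linarith
    then show "ball (c u) (r u) \<inter> ball (c v) (r v) = {}"
      by (intro equals0I) (simp, blast)
  qed
  let ?w = "unit_ball_vol (real DIM('a))"
  have "?w * (\<Sum>u\<in>I. r u ^ DIM('a)) = (\<Sum>u\<in>I. measure lborel (ball (c u) (r u)))"
    using r by (auto simp: sum_distrib_left content_ball less_imp_le intro!: sum.cong)
  also have "\<dots> = measure lborel (\<Union>u\<in>I. ball (c u) (r u))"
  proof (rule measure_finite_Union[symmetric])
    show "emeasure lborel (ball (c i) (r i)) \<noteq> \<infinity>" for i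
      using emeasure_bounded_finite[of "ball (c i) (r i)"] by auto
  qed (use I disj in auto)
  also have "\<dots> \<le> measure lborel (cball x R)"
  proof (rule measure_mono_fmeasurable)
    show "cball x R \<in> fmeasurable lborel"
      using emeasure_bounded_finite[of "cball x R"] by (auto intro!: fmeasurableI)
    show "(\<Union>u\<in>I. ball (c u) (r u)) \<subseteq> cball x R"
    proof safe
      fix u z assume u: "u \<in> I" "z \<in> ball (c u) (r u)"
      then show "z \<in> cball x R"
        using R(1)[OF u(1)] dist_triangle[of x z "c u"] by (simp)
    qed
  qed (use I in auto)
  also have "\<dots> = ?w * R ^ DIM('a)"
    using R by (simp add: content_cball)
  finally show ?thesis
    using unit_ball_vol_pos[of "real DIM('a)"] by simp
qed

text \<open>Induction over dyadic annuli. A ball centred at distance between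
  \<open>2 ^ n * \<alpha>\<close> and twice that from \<open>x\<close> has radius at most this
  distance, so it lies in the ball of radius \<open>4 * (2 ^ n * \<alpha>)\<close> about
  \<open>x\<close>. With the distance replaced by the inner radius, the volume bound leaves
  \<open>4 ^ DIM('a)\<close> for each annulus.\<close>

lemma sum_annulus_le:
  fixes c :: "'v \<Rightarrow> 'a::euclidean_space"
  assumes I: "finite I" and r: "\<And>u. u \<in> I \<Longrightarrow> 0 < r u"
    and sep: "\<And>u v. u \<in> I \<Longrightarrow> v \<in> I \<Longrightarrow> u \<noteq> v \<Longrightarrow> r u + r v \<le> dist (c u) (c v)"
    and x: "\<And>u. u \<in> I \<Longrightarrow> r u \<le> dist x (c u)"
    and \<alpha>: "0 < \<alpha>" "\<And>u. u \<in> I \<Longrightarrow> \<alpha> \<le> dist x (c u)" "\<And>u. u \<in> I \<Longrightarrow> dist x (c u) < 2 ^ n * \<alpha>"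
  shows "(\<Sum>u\<in>I. (r u / dist x (c u)) ^ DIM('a)) \<le> real n * 4 ^ DIM('a)"
  using assms
proof (induction n arbitrary: I)
  case 0
  then have "I = {}" by fastforce
  then show ?case by simp
next
  case (Suc n)
  define J where "J = {u\<in>I. dist x (c u) < 2 ^ n * \<alpha>}"
  define L where "L = {u\<in>I. 2 ^ n * \<alpha> \<le> dist x (c u)}"
  have IJ: "I = J \<union> L" "J \<inter> L = {}" by (auto simp: J_def L_def)
  have fin: "finite J" "finite L" using Suc.prems(1) by (auto simp: J_def L_def)
  have pos: "0 < 2 ^ n * \<alpha>" using Suc.prems by simp
  have 1: "(\<Sum>u\<in>J. (r u / dist x (c u)) ^ DIM('a)) \<le> real n * 4 ^ DIM('a)"
    using Suc.prems fin by (intro Suc.IH) (auto simp: J_def)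
  have "(\<Sum>u\<in>L. (r u / dist x (c u)) ^ DIM('a)) \<le> (\<Sum>u\<in>L. (r u / (2 ^ n * \<alpha>)) ^ DIM('a))"
  proof (rule sum_mono)
    fix u assume u: "u \<in> L"
    then have "0 < r u" "2 ^ n * \<alpha> \<le> dist x (c u)" using Suc.prems by (auto simp: L_def)
    then show "(r u / dist x (c u)) ^ DIM('a) \<le> (r u / (2 ^ n * \<alpha>)) ^ DIM('a)"
      using pos by (intro power_mono frac_le divide_nonneg_nonneg) auto
  qed
  also have "\<dots> = (\<Sum>u\<in>L. r u ^ DIM('a)) / (2 ^ n * \<alpha>) ^ DIM('a)"
    by (simp add: sum_divide_distrib power_divide)
  also have "\<dots> \<le> (4 * (2 ^ n * \<alpha>)) ^ DIM('a) / (2 ^ n * \<alpha>) ^ DIM('a)"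
  proof (intro divide_right_mono sum_radii_power_le[where x = x and c = c])
    fix u assume "u \<in> L"
    then have "u \<in> I" by (simp add: L_def)
    then show "dist x (c u) + r u \<le> 4 * (2 ^ n * \<alpha>)"
      using Suc.prems(4,7)[of u] by simp
  qed (use fin pos Suc.prems in \<open>auto simp: L_def\<close>)
  also have "\<dots> = 4 ^ DIM('a)"
    using pos unfolding power_mult_distrib by (auto simp: power_mult_distrib)
  finally show ?case
    using 1 fin IJ by (simp add: sum.union_disjoint algebra_simps)
qed

section \<open>The magic lemma\<close>

lemma sum_card_fibres: "finite S \<Longrightarrow> (\<Sum>y\<in>f ` S. card {x\<in>S. f x = y}) = card S"
  using sum.image_gen[of S "\<lambda>_. 1::nat" f] by simp

text \<open>Truncation at \<open>t\<close> is subadditive: either one fibre alone reaches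
  \<open>t\<close>, or nothing is truncated and the sum counts all of \<open>S\<close>.\<close>

lemma sum_min_card_fibres_ge:
  assumes "finite S"
  shows "min t (card S) \<le> (\<Sum>y\<in>f ` S. min t (card {x\<in>S. f x = y}))"
proof (cases "\<exists>y\<in>f ` S. t \<le> card {x\<in>S. f x = y}")
  case True
  then obtain y where y: "y \<in> f ` S" "t \<le> card {x\<in>S. f x = y}" by blast
  have "min t (card {x\<in>S. f x = y}) \<le> (\<Sum>y\<in>f ` S. min t (card {x\<in>S. f x = y}))"
    using assms y by (intro member_le_sum) auto
  then show ?thesis using y by simp
next
  case False
  then have "(\<Sum>y\<in>f ` S. min t (card {x\<in>S. f x = y})) = (\<Sum>y\<in>f ` S. card {x\<in>S. f x = y})"
    by (intro sum.cong) auto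
  also have "\<dots> = card S"
    using assms by (rule sum_card_fibres)
  finally show ?thesis by simp
qed

text \<open>If one fibre reaches \<open>t\<close>, it contributes \<open>t\<close>, and the points
  outside it are numerous enough to contribute another \<open>t\<close> by subadditivity. If none
  does, nothing is truncated and \<open>S\<close> itself has at least \<open>2 * t\<close>
  points.\<close>

lemma sum_min_card_fibres_ge_double:
  assumes S: "finite S" and sup: "\<And>y. y \<in> f ` S \<Longrightarrow> 2 * t \<le> card {x\<in>S. f x \<noteq> y}" and ne: "S \<noteq> {}"
  shows "2 * t \<le> (\<Sum>y\<in>f ` S. min t (card {x\<in>S. f x = y}))"
proof (cases "\<exists>y\<in>f ` S. t \<le> card {x\<in>S. f x = y}")
  case True
  then obtain y where y: "y \<in> f ` S" "t \<le> card {x\<in>S. f x = y}" by blast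
  define T where "T = {x\<in>S. f x \<noteq> y}"
  have fT: "f ` T = f ` S - {y}" by (auto simp: T_def)
  have "t \<le> min t (card T)" using sup[OF y(1)] by (simp add: T_def)
  also have "\<dots> \<le> (\<Sum>z\<in>f ` T. min t (card {x\<in>T. f x = z}))"
    using S by (intro sum_min_card_fibres_ge) (simp add: T_def)
  also have "\<dots> = (\<Sum>z\<in>f ` S - {y}. min t (card {x\<in>S. f x = z}))"
    unfolding fT by (intro sum.cong refl arg_cong[of _ _ "\<lambda>A. min t (card A)"]) (auto simp: T_def)
  finally show ?thesis
    using y sum.remove[of "f ` S" y "\<lambda>z. min t (card {x\<in>S. f x = z})"] S by simp
next
  case False
  then have "(\<Sum>y\<in>f ` S. min t (card {x\<in>S. f x = y})) = (\<Sum>y\<in>f ` S. card {x\<in>S. f x = y})"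
    by (intro sum.cong) auto
  also have "\<dots> = card S"
    using S by (rule sum_card_fibres)
  moreover obtain x where "x \<in> S" using ne by blast
  then have "2 * t \<le> card {y\<in>S. f y \<noteq> f x}" using sup by blast
  then have "2 * t \<le> card S" by (rule order_trans) (auto intro: card_mono S)
  ultimately show ?thesis by simp
qed

text \<open>The supported cells of the magic lemma, with \<open>P\<close> labelling a coarse
  partition and \<open>Q\<close> a finer one: no single fine cell carries nearly all points of the
  coarse cell.\<close>

definition supported_cells :: "'v set \<Rightarrow> nat \<Rightarrow> ('v \<Rightarrow> 'b) \<Rightarrow> ('v \<Rightarrow> 'e) \<Rightarrow> 'b set" where
  "supported_cells C t P Q =
     {z \<in> P ` C. \<forall>y\<in>C. 2 * t \<le> card {x\<in>C. P x = z \<and> Q x \<noteq> Q y}}"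

text \<open>The truncated count acts as a potential. Merging fine cells into a coarse one never
  increases it, and in a supported cell it falls from at least \<open>2 * t\<close> to at most
  \<open>t\<close>.\<close>

lemma truncated_cell_sum_drop:
  assumes C: "finite C" and ref: "\<And>x y. x \<in> C \<Longrightarrow> y \<in> C \<Longrightarrow> Q x = Q y \<Longrightarrow> P x = P y"
  shows "(\<Sum>z\<in>P ` C. min t (card {x\<in>C. P x = z})) + t * card (supported_cells C t P Q)
    \<le> (\<Sum>y\<in>Q ` C. min t (card {x\<in>C. Q x = y}))"
proof -
  define S where "S z = {x\<in>C. P x = z}" for z
  have finS: "finite (S z)" for z using C by (simp add: S_def)
  have sub: "supported_cells C t P Q \<subseteq> P ` C" by (auto simp: supported_cells_def)
  have "t * card (supported_cells C t P Q) = (\<Sum>z\<in>P ` C. if z \<in> supported_cells C t P Q then t else 0)"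
    using C sub by (simp add: sum.If_cases Int_absorb1 mult.commute)
  then have "(\<Sum>z\<in>P ` C. min t (card {x\<in>C. P x = z})) + t * card (supported_cells C t P Q)
      = (\<Sum>z\<in>P ` C. min t (card (S z)) + (if z \<in> supported_cells C t P Q then t else 0))"
    by (simp add: sum.distrib S_def)
  also have "\<dots> \<le> (\<Sum>z\<in>P ` C. \<Sum>y\<in>Q ` S z. min t (card {x\<in>S z. Q x = y}))"
  proof (rule sum_mono)
    fix z assume z: "z \<in> P ` C"
    show "min t (card (S z)) + (if z \<in> supported_cells C t P Q then t else 0)
      \<le> (\<Sum>y\<in>Q ` S z. min t (card {x\<in>S z. Q x = y}))"
    proof (cases "z \<in> supported_cells C t P Q")
      case True
      have "2 * t \<le> card {x\<in>S z. Q x \<noteq> y}" if "y \<in> Q ` S z" for y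
      proof -
        from that obtain w where "w \<in> C" "y = Q w" unfolding S_def by blast
        moreover have "{x\<in>S z. Q x \<noteq> y} = {x\<in>C. P x = z \<and> Q x \<noteq> y}" by (auto simp: S_def)
        ultimately show ?thesis using True by (simp add: supported_cells_def)
      qed
      then have "2 * t \<le> (\<Sum>y\<in>Q ` S z. min t (card {x\<in>S z. Q x = y}))"
        using z by (intro sum_min_card_fibres_ge_double finS) (auto simp: S_def)
      then show ?thesis using True by simp
    next
      case False
      then show ?thesis using sum_min_card_fibres_ge[OF finS] by simp
    qed
  qed
  also have "\<dots> = (\<Sum>z\<in>P ` C. \<Sum>y\<in>Q ` S z. min t (card {x\<in>C. Q x = y}))"
  proof (intro sum.cong refl)
    fix z y assume "y \<in> Q ` S z"
    then have "{x\<in>S z. Q x = y} = {x\<in>C. Q x = y}" unfolding S_def using ref by blast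
    then show "min t (card {x\<in>S z. Q x = y}) = min t (card {x\<in>C. Q x = y})" by simp
  qed
  also have "\<dots> = (\<Sum>y\<in>(\<Union>z\<in>P ` C. Q ` S z). min t (card {x\<in>C. Q x = y}))"
  proof (rule sum.UNION_disjoint[symmetric])
    show "\<forall>i\<in>P ` C. \<forall>j\<in>P ` C. i \<noteq> j \<longrightarrow> Q ` S i \<inter> Q ` S j = {}"
    proof (intro ballI impI equals0I)
      fix i j y assume ij: "i \<noteq> j" and "y \<in> Q ` S i \<inter> Q ` S j"
      then obtain u v where "u \<in> S i" "v \<in> S j" "Q u = Q v" by auto
      then show False using ref[of u v] ij by (simp add: S_def)
    qed
  qed (use C finS in auto)
  also have "(\<Union>z\<in>P ` C. Q ` S z) = Q ` C" by (auto simp: S_def)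
  finally show ?thesis .
qed

lemma sum_up_add: "(\<Sum>k<a + N. f k) = (\<Sum>k<a. f k) + (\<Sum>k<N. f (k + a :: nat) :: nat)"
  by (induction N) (simp_all add: add.commute add.left_commute)

text \<open>Between the levels \<open>k\<close> and \<open>k + a\<close> the potential
  \<open>\<Phi>\<close> drops by at least \<open>t\<close> for each supported cell. Summed over
  \<open>k\<close>, all but the first \<open>a\<close> values cancel, and each of these is at most
  \<open>card C\<close>. Hence the bound does not grow with the number \<open>N\<close> of
  scales.\<close>

lemma card_supported_cells_le:
  assumes C: "finite C" and nest: "\<And>k x y. \<pi> k x = \<pi> k y \<Longrightarrow> \<pi> (Suc k) x = \<pi> (Suc k) y"
  shows "t * (\<Sum>k<N. card (supported_cells C t (\<pi> (k + a)) (\<pi> k))) \<le> a * card C"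
proof -
  define \<Phi> where "\<Phi> k = (\<Sum>z\<in>\<pi> k ` C. min t (card {x\<in>C. \<pi> k x = z}))" for k
  have up: "\<pi> (k + j) x = \<pi> (k + j) y" if "\<pi> k x = \<pi> k y" for k j x y
  proof (induction j)
    case (Suc j)
    from nest[OF this] show ?case by simp
  qed (use that in simp)
  have step: "\<Phi> (k + a) + t * card (supported_cells C t (\<pi> (k + a)) (\<pi> k)) \<le> \<Phi> k" for k
    unfolding \<Phi>_def by (rule truncated_cell_sum_drop[OF C up])
  have \<Phi>: "\<Phi> k \<le> card C" for k
  proof -
    have "\<Phi> k \<le> (\<Sum>z\<in>\<pi> k ` C. card {x\<in>C. \<pi> k x = z})" unfolding \<Phi>_def by (rule sum_mono) simp
    then show ?thesis by (simp add: sum_card_fibres[OF C])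
  qed
  have "(\<Sum>k<N. \<Phi> (k + a)) + t * (\<Sum>k<N. card (supported_cells C t (\<pi> (k + a)) (\<pi> k)))
      \<le> (\<Sum>k<N. \<Phi> k)"
    using sum_mono[of "{..<N}", OF step] by (simp add: sum.distrib sum_distrib_left)
  \<comment> \<open>Enlarging the range to \<open>N + a\<close> and splitting off the first
    \<open>a\<close> terms reproduces the shifted sum of the left-hand side, which then
    cancels.\<close>
  also have "\<dots> \<le> (\<Sum>k<N + a. \<Phi> k)" by (intro sum_mono2) auto
  also have "\<dots> = (\<Sum>k<a. \<Phi> k) + (\<Sum>k<N. \<Phi> (k + a))"
    unfolding add.commute[of N a] by (rule sum_up_add)
  also have "(\<Sum>k<a. \<Phi> k) \<le> a * card C"
    using sum_bounded_above[of "{..<a}" \<Phi> "card C"] \<Phi> by simp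
  finally show ?thesis by simp
qed

section \<open>Shifted triadic grids\<close>

text \<open>The mesh ratio is odd so that the grids shifted by half a mesh are nested, too.\<close>

definition grid_cell :: "real \<Rightarrow> ('d \<Rightarrow> bool) \<Rightarrow> nat \<Rightarrow> real ^ 'd \<Rightarrow> int ^ 'd" where
  "grid_cell \<tau> b k x = (\<chi> i. \<lfloor>x $ i / (\<tau> * 3 ^ k) + (if b i then 1 / 2 else 0)\<rfloor>)"

text \<open>Each coarse index is a function of the fine one: the integer quotient by 3, after adding
  1 in the shifted coordinates because \<open>z / 3 + 1 / 2 = (z + 1 / 2 + 1) / 3\<close>.\<close>

lemma grid_cell_nested:
  assumes "grid_cell \<tau> b k x = grid_cell \<tau> b k y"
  shows "grid_cell \<tau> b (Suc k) x = grid_cell \<tau> b (Suc k) y"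
proof -
  have *: "\<lfloor>z / 3 + (if e then 1 / 2 else 0)\<rfloor> =
      (\<lfloor>z + (if e then 1 / 2 else 0)\<rfloor> + (if e then 1 else 0)) div 3" for z :: real and e
  proof (cases e)
    case True
    have "z / 3 + 1 / 2 = (z + 1 / 2 + of_int 1) / of_int 3" by simp
    then have "\<lfloor>z / 3 + 1 / 2\<rfloor> = \<lfloor>z + 1 / 2 + of_int 1\<rfloor> div 3"
      by (simp only: floor_divide_real_eq_div)
    also have "\<lfloor>z + 1 / 2 + of_int 1\<rfloor> = \<lfloor>z + 1 / 2\<rfloor> + 1" by (rule floor_add_int[symmetric])
    finally show ?thesis using True by simp
  next
    case False
    then show ?thesis using floor_divide_real_eq_div[of 3 z] by simp
  qed
  have s: "w / (\<tau> * 3 ^ Suc k) = w / (\<tau> * 3 ^ k) / 3" for w :: real by simp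
  show ?thesis
    using assms unfolding grid_cell_def s * vec_eq_iff vec_lambda_beta by simp
qed

lemma dist_grid_cell_le:
  fixes x y :: "real ^ 'd"
  assumes "grid_cell \<tau> b k x = grid_cell \<tau> b k y" and \<tau>: "0 < \<tau>"
  shows "dist x y \<le> real CARD('d) * (\<tau> * 3 ^ k)"
proof -
  define T where "T = \<tau> * 3 ^ k"
  have T: "0 < T" using \<tau> by (simp add: T_def)
  have *: "\<bar>(x - y) $ i\<bar> \<le> T" for i
  proof -
    let ?e = "if b i then 1 / 2 else 0 :: real"
    have "\<lfloor>x $ i / T + ?e\<rfloor> = \<lfloor>y $ i / T + ?e\<rfloor>"
      using assms(1) by (simp add: grid_cell_def vec_eq_iff T_def)
    then have "\<bar>x $ i / T - y $ i / T\<bar> \<le> 1" by linarith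
    also have "x $ i / T - y $ i / T = (x - y) $ i / T" by (simp add: diff_divide_distrib)
    also have "\<bar>(x - y) $ i / T\<bar> = \<bar>(x - y) $ i\<bar> / T" using T by simp
    finally show ?thesis unfolding pos_divide_le_eq[OF T] by simp
  qed
  have "dist x y \<le> (\<Sum>i\<in>UNIV. \<bar>(x - y) $ i\<bar>)"
    unfolding dist_norm by (rule norm_le_l1_cart)
  also have "\<dots> \<le> (\<Sum>i\<in>(UNIV :: 'd set). T)" by (rule sum_mono[OF *])
  finally show ?thesis by (simp add: T_def)
qed

text \<open>
  The unshifted and the half-shifted grid points of mesh \<open>1\<close> are \<open>1/2\<close> apart together, so
  a short interval crosses at most one of the two grids.
\<close>

lemma floor_shift_stable:
  fixes z :: real
  obtains e where "\<And>y. \<bar>y - z\<bar> < 1 / 4 \<Longrightarrow>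
    \<lfloor>y + (if e then 1 / 2 else 0)\<rfloor> = \<lfloor>z + (if e then 1 / 2 else 0)\<rfloor>"
proof -
  define n where "n = real_of_int \<lfloor>z\<rfloor>"
  have n: "n \<le> z" "z < n + 1" unfolding n_def by linarith+
  consider "n + 1 / 4 \<le> z" "z < n + 3 / 4" | "z < n + 1 / 4" | "n + 3 / 4 \<le> z" by linarith
  then show ?thesis
  proof cases
    case 1
    have "\<lfloor>y\<rfloor> = \<lfloor>z\<rfloor>" if "\<bar>y - z\<bar> < 1 / 4" for y
      by (rule floor_unique; fold n_def; use 1 that in linarith)
    from that[of False, unfolded if_False add_0_right, OF this] show ?thesis .
  next
    case 2
    have *: "\<lfloor>y + 1 / 2\<rfloor> = \<lfloor>z\<rfloor>" if "\<bar>y - z\<bar> < 1 / 4" for y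
      by (rule floor_unique; fold n_def; use 2 n that in linarith)
    have "\<lfloor>y + 1 / 2\<rfloor> = \<lfloor>z + 1 / 2\<rfloor>" if "\<bar>y - z\<bar> < 1 / 4" for y
      unfolding *[OF that] by (rule *[of z, symmetric]) simp
    from that[of True, unfolded if_True, OF this] show ?thesis .
  next
    case 3
    have *: "\<lfloor>y + 1 / 2\<rfloor> = \<lfloor>z\<rfloor> + 1" if "\<bar>y - z\<bar> < 1 / 4" for y
      by (rule floor_unique; unfold of_int_add of_int_1; fold n_def; use 3 n that in linarith)
    have "\<lfloor>y + 1 / 2\<rfloor> = \<lfloor>z + 1 / 2\<rfloor>" if "\<bar>y - z\<bar> < 1 / 4" for y
      unfolding *[OF that] by (rule *[of z, symmetric]) simp
    from that[of True, unfolded if_True, OF this] show ?thesis .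
  qed
qed

text \<open>In units of the mesh the ball extends by less than \<open>1 / 4\<close> in every
  coordinate, so a suitable shift can be chosen coordinate by coordinate. This is why all
  \<open>2 ^ CARD('d)\<close> patterns of shifts are considered.\<close>

lemma cball_in_shifted_grid_cell:
  fixes x :: "real ^ 'd"
  assumes "0 < \<tau>" "4 * \<rho> < \<tau> * 3 ^ k"
  obtains b where "\<And>y. dist x y \<le> \<rho> \<Longrightarrow> grid_cell \<tau> b k y = grid_cell \<tau> b k x"
proof -
  define T where "T = \<tau> * 3 ^ k"
  have T: "0 < T" "4 * \<rho> < T" using assms by (simp_all add: T_def)
  have "\<forall>i. \<exists>e. \<forall>y. \<bar>y - x $ i / T\<bar> < 1 / 4 \<longrightarrow>
    \<lfloor>y + (if e then 1 / 2 else 0)\<rfloor> = \<lfloor>x $ i / T + (if e then 1 / 2 else 0)\<rfloor>"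
    (is "\<forall>i. \<exists>e. ?stable i e")
  proof
    fix i
    show "\<exists>e. ?stable i e"
    proof (rule floor_shift_stable[of "x $ i / T"], rule exI, intro allI impI)
      fix e y
      assume "\<And>y. \<bar>y - x $ i / T\<bar> < 1 / 4 \<Longrightarrow>
        \<lfloor>y + (if e then 1 / 2 else 0)\<rfloor> = \<lfloor>x $ i / T + (if e then 1 / 2 else 0)\<rfloor>"
        "\<bar>y - x $ i / T\<bar> < 1 / 4"
      then show "\<lfloor>y + (if e then 1 / 2 else 0)\<rfloor> = \<lfloor>x $ i / T + (if e then 1 / 2 else 0)\<rfloor>" .
    qed
  qed
  from choice[OF this] obtain b where "\<forall>i. ?stable i (b i)" ..
  note b = this[rule_format]
  have "grid_cell \<tau> b k y = grid_cell \<tau> b k x" if "dist x y \<le> \<rho>" for y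
  proof -
    have "\<bar>y $ i / T - x $ i / T\<bar> < 1 / 4" for i
    proof -
      have "\<bar>y $ i - x $ i\<bar> \<le> \<rho>"
        using that component_le_norm_cart[of "x - y" i] by (simp add: dist_norm)
      then have "4 * \<bar>y $ i - x $ i\<bar> \<le> 4 * \<rho>" by (rule mult_left_mono) simp
      also have "\<dots> < T" by (rule T)
      finally have "\<bar>y $ i - x $ i\<bar> < 1 / 4 * T" by simp
      then have "\<bar>y $ i - x $ i\<bar> / T < 1 / 4" unfolding pos_divide_less_eq[OF T(1)] .
      also have "\<bar>y $ i - x $ i\<bar> / T = \<bar>y $ i / T - x $ i / T\<bar>"
        using T by (simp add: diff_divide_distrib[symmetric])
      finally show ?thesis .
    qed
    from b[OF this] show ?thesis unfolding grid_cell_def vec_eq_iff vec_lambda_beta T_def[symmetric] ..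
  qed
  then show ?thesis by (rule that)
qed

text \<open>Every radius is at least \<open>T / B\<close>, and all the balls lie within
  \<open>(D + 1) * T\<close> of any one of the centres, so volume bounds their number.\<close>

lemma card_comparable_radii_le:
  fixes c :: "'v \<Rightarrow> 'a::euclidean_space"
  assumes W: "finite W" and r: "\<And>u. u \<in> W \<Longrightarrow> 0 < r u"
    and sep: "\<And>u v. u \<in> W \<Longrightarrow> v \<in> W \<Longrightarrow> u \<noteq> v \<Longrightarrow> r u + r v \<le> dist (c u) (c v)"
    and T: "\<And>u. u \<in> W \<Longrightarrow> r u \<le> T" "\<And>u. u \<in> W \<Longrightarrow> T \<le> B * r u" "0 < B"
    and D: "\<And>u v. u \<in> W \<Longrightarrow> v \<in> W \<Longrightarrow> dist (c u) (c v) \<le> D * T" "0 \<le> D"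
  shows "real (card W) \<le> (B * (D + 1)) ^ DIM('a)"
proof (cases "W = {}")
  case True
  then show ?thesis using T(3) D(2) by simp
next
  case False
  then obtain w where w: "w \<in> W" by blast
  have T0: "0 < T" using less_le_trans[OF r[OF w] T(1)[OF w]] .
  have "real (card W) * (T / B) ^ DIM('a) = (\<Sum>u\<in>W. (T / B) ^ DIM('a))" by simp
  also have "\<dots> \<le> (\<Sum>u\<in>W. r u ^ DIM('a))"
    using T T0 by (intro sum_mono power_mono) (auto simp: divide_le_eq mult.commute)
  also have "\<dots> \<le> ((D + 1) * T) ^ DIM('a)"
  proof (rule sum_radii_power_le[OF W r sep, where x = "c w"])
    fix u assume "u \<in> W"
    then show "dist (c w) (c u) + r u \<le> (D + 1) * T"
      using D(1)[OF w, of u] T(1)[of u] by (simp add: algebra_simps)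
  qed (use T0 D in auto)
  also have "\<dots> = (B * (D + 1)) ^ DIM('a) * (T / B) ^ DIM('a)"
    using T(3) by (simp add: power_mult_distrib[symmetric] mult.commute)
  finally show ?thesis using T0 T(3) by simp
qed

text \<open>
  This is the magic lemma of Benjamini and Schramm: seen at the scale of their own radius, most
  centres of a packing cluster around one point. A centre violating this makes one of the
  \<open>2 ^ d\<close> shifted grid cells of comparable size supported, and a cell is hit boundedly often.
\<close>

lemma card_non_clustering_le:
  fixes c :: "'v \<Rightarrow> real ^ 'd"
  assumes V: "finite V" and r: "\<And>u. u \<in> V \<Longrightarrow> 0 < r u"
    and sep: "\<And>u v. u \<in> V \<Longrightarrow> v \<in> V \<Longrightarrow> u \<noteq> v \<Longrightarrow> r u + r v \<le> dist (c u) (c v)"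
    and K: "1 \<le> K" and a: "real CARD('d) * 12 * K\<^sup>2 \<le> 3 ^ a"
    and N: "(12 * K * (real CARD('d) + 1)) ^ CARD('d) \<le> real N"
  shows "t * card {v\<in>V. \<forall>q\<in>V. 2 * t \<le> card {u\<in>V. dist (c v) (c u) \<le> K * r v \<and> r v / K < dist (c q) (c u)}}
    \<le> N * 2 ^ CARD('d) * (a * card V)" (is "t * card ?Bad \<le> _")
proof (cases "V = {}")
  case True then show ?thesis by simp
next
  case ne: False
  \<comment> \<open>This makes the mesh at level \<open>a\<close> equal to \<open>4 * K\<close>
    times the least radius, so that the upper bound \<open>\<kappa>2\<close> also holds when
    \<open>\<kappa> v = 0\<close>, where minimality of \<open>\<kappa> v\<close> gives
    nothing.\<close>
  define \<tau> where "\<tau> = 4 * K * Min (r ` V) / 3 ^ a"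
  have "0 < Min (r ` V)" using V ne r by simp
  then have \<tau>: "0 < \<tau>" using K by (simp add: \<tau>_def)
  \<comment> \<open>The coarse level for \<open>v\<close> is \<open>\<kappa> v + a\<close>, the
    first from \<open>a\<close> on at which a cell can hold the ball of radius
    \<open>K * r v\<close>. The fine level is \<open>\<kappa> v\<close>; the hypothesis on
    \<open>a\<close> makes its cells of diameter at most \<open>r v / K\<close>.\<close>
  define \<kappa> where "\<kappa> v = (LEAST k. 4 * K * r v < \<tau> * 3 ^ (k + a))" for v
  have \<kappa>1: "4 * K * r v < \<tau> * 3 ^ (\<kappa> v + a)" for v
    unfolding \<kappa>_def
  proof (rule LeastI_ex)
    obtain k where "4 * K * r v / \<tau> < 3 ^ k" using real_arch_pow[of 3] by auto
    also have "(3::real) ^ k \<le> 3 ^ (k + a)" by (rule power_increasing) auto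
    finally show "\<exists>k. 4 * K * r v < \<tau> * 3 ^ (k + a)"
      using \<tau> by (intro exI[of _ k]) (simp add: pos_divide_less_eq mult.commute)
  qed
  have \<kappa>2: "\<tau> * 3 ^ (\<kappa> v + a) \<le> 12 * K * r v" if "v \<in> V" for v
  proof (cases "\<kappa> v")
    case 0
    have "Min (r ` V) \<le> r v" using V that by simp
    then have "4 * K * Min (r ` V) \<le> 12 * K * r v"
      using K r[OF that] \<open>0 < Min (r ` V)\<close> by (intro mult_mono) auto
    then show ?thesis using 0 by (simp add: \<tau>_def)
  next
    case (Suc k)
    then have "\<not> 4 * K * r v < \<tau> * 3 ^ (k + a)"
      using not_less_Least[of k "\<lambda>k. 4 * K * r v < \<tau> * 3 ^ (k + a)"] by (simp add: \<kappa>_def)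
    then show ?thesis using Suc by simp
  qed
  define L where "L = Suc (Max (\<kappa> ` V))"
  have L: "\<kappa> v < L" if "v \<in> V" for v using V that by (simp add: L_def less_Suc_eq_le)
  define \<pi> where "\<pi> b k u = grid_cell \<tau> b k (c u)" for b k u
  define S where "S b k = supported_cells V t (\<pi> b (k + a)) (\<pi> b k)" for b k
  \<comment> \<open>The centres in \<open>W b k z\<close> share a coarse cell and have radii
    comparable to its mesh, so there are at most \<open>N\<close> of them. Charging each bad centre
    to a supported cell therefore hits a cell at most \<open>N\<close> times for each shift and
    level.\<close>
  define W where "W b k z = {v\<in>V. 4 * K * r v < \<tau> * 3 ^ (k + a) \<and> \<tau> * 3 ^ (k + a) \<le> 12 * K * r v
      \<and> \<pi> b (k + a) v = z}" for b k z
  have W: "card (W b k z) \<le> N" for b k z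
  proof -
    have "real (card (W b k z)) \<le> (12 * K * (real CARD('d) + 1)) ^ DIM(real ^ 'd)"
    proof (rule card_comparable_radii_le[where T = "\<tau> * 3 ^ (k + a)" and c = c and r = r])
      show "r u \<le> \<tau> * 3 ^ (k + a)" if "u \<in> W b k z" for u
      proof -
        have "1 * r u \<le> 4 * K * r u" using that K r[of u] by (intro mult_right_mono) (auto simp: W_def)
        then show ?thesis using that by (auto simp: W_def)
      qed
      show "dist (c u) (c v) \<le> real CARD('d) * (\<tau> * 3 ^ (k + a))" if "u \<in> W b k z" "v \<in> W b k z" for u v
        using that \<tau> by (intro dist_grid_cell_le[of _ b]) (auto simp: W_def \<pi>_def)
      show "finite (W b k z)" using V by (simp add: W_def)
      show "0 < r u" if "u \<in> W b k z" for u using that r by (simp add: W_def)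
      show "r u + r v \<le> dist (c u) (c v)" if "u \<in> W b k z" "v \<in> W b k z" "u \<noteq> v" for u v
        using that sep[of u v] by (simp add: W_def)
      show "\<tau> * 3 ^ (k + a) \<le> 12 * K * r u" if "u \<in> W b k z" for u using that by (simp add: W_def)
    qed (use K in auto)
    then have "real (card (W b k z)) \<le> real N" using N by simp
    then show ?thesis by simp
  qed
  have finS: "finite (S b k)" for b k using V by (auto simp: S_def supported_cells_def)
  have finW: "finite (W b k z)" for b k z using V by (auto simp: W_def)
  have "?Bad \<subseteq> (\<Union>b. \<Union>k<L. \<Union>z\<in>S b k. W b k z)"
  proof
    fix v assume "v \<in> ?Bad"
    then have v: "v \<in> V" and bad: "\<And>q. q \<in> V \<Longrightarrow>
        2 * t \<le> card {u\<in>V. dist (c v) (c u) \<le> K * r v \<and> r v / K < dist (c q) (c u)}" by auto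
    have "4 * (K * r v) < \<tau> * 3 ^ (\<kappa> v + a)" using \<kappa>1[of v] by simp
    then obtain b where b: "\<And>y. dist (c v) y \<le> K * r v \<Longrightarrow>
        grid_cell \<tau> b (\<kappa> v + a) y = grid_cell \<tau> b (\<kappa> v + a) (c v)"
      using cball_in_shifted_grid_cell[OF \<tau>] by metis
    have small: "real CARD('d) * (\<tau> * 3 ^ \<kappa> v) \<le> r v / K"
    proof -
      have "real CARD('d) * (\<tau> * 3 ^ \<kappa> v) * 3 ^ a = real CARD('d) * (\<tau> * 3 ^ (\<kappa> v + a))"
        by (simp add: power_add)
      also have "\<dots> \<le> real CARD('d) * (12 * K * r v)" using \<kappa>2[OF v] by (intro mult_left_mono) auto
      also have "\<dots> = (real CARD('d) * 12 * K\<^sup>2) * (r v / K)" using K by (simp add: power2_eq_square)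
      also have "\<dots> \<le> 3 ^ a * (r v / K)" using a K r[OF v] by (intro mult_right_mono) auto
      finally have "real CARD('d) * (\<tau> * 3 ^ \<kappa> v) * 3 ^ a \<le> r v / K * 3 ^ a" by (simp only: mult.commute)
      then show ?thesis by (rule mult_right_le_imp_le) simp
    qed
    \<comment> \<open>The coarse cell contains all centres within \<open>K * r v\<close> of
      \<open>v\<close>, while the fine cell of \<open>q\<close> stays within \<open>r v / K\<close>
      of \<open>q\<close>. So the centres witnessing that \<open>v\<close> is bad lie in the coarse
      cell but outside the fine one.\<close>
    have "\<pi> b (\<kappa> v + a) v \<in> S b (\<kappa> v)"
      unfolding S_def supported_cells_def
    proof (intro CollectI conjI ballI)
      fix q assume q: "q \<in> V"
      have "2 * t \<le> card {u\<in>V. dist (c v) (c u) \<le> K * r v \<and> r v / K < dist (c q) (c u)}"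
        by (rule bad[OF q])
      also have "\<dots> \<le> card {u\<in>V. \<pi> b (\<kappa> v + a) u = \<pi> b (\<kappa> v + a) v \<and> \<pi> b (\<kappa> v) u \<noteq> \<pi> b (\<kappa> v) q}"
      proof (rule card_mono)
        show "{u\<in>V. dist (c v) (c u) \<le> K * r v \<and> r v / K < dist (c q) (c u)}
           \<subseteq> {u\<in>V. \<pi> b (\<kappa> v + a) u = \<pi> b (\<kappa> v + a) v \<and> \<pi> b (\<kappa> v) u \<noteq> \<pi> b (\<kappa> v) q}"
        proof safe
          fix u assume u: "dist (c v) (c u) \<le> K * r v"
          then show "\<pi> b (\<kappa> v + a) u = \<pi> b (\<kappa> v + a) v" unfolding \<pi>_def by (rule b)
        next
          fix u assume u: "r v / K < dist (c q) (c u)" "\<pi> b (\<kappa> v) u = \<pi> b (\<kappa> v) q"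
          then show False
            using dist_grid_cell_le[of \<tau> b "\<kappa> v" "c q" "c u"] \<tau> small by (simp add: \<pi>_def)
        qed
      qed (use V in auto)
      finally show "2 * t \<le> card {u\<in>V. \<pi> b (\<kappa> v + a) u = \<pi> b (\<kappa> v + a) v \<and> \<pi> b (\<kappa> v) u \<noteq> \<pi> b (\<kappa> v) q}" .
    qed (use v in auto)
    moreover have "v \<in> W b (\<kappa> v) (\<pi> b (\<kappa> v + a) v)"
      using v \<kappa>1[of v] \<kappa>2[OF v] by (simp add: W_def)
    ultimately show "v \<in> (\<Union>b. \<Union>k<L. \<Union>z\<in>S b k. W b k z)" using L[OF v] by blast
  qed
  then have "card ?Bad \<le> card (\<Union>b. \<Union>k<L. \<Union>z\<in>S b k. W b k z)"
    using finS finW by (intro card_mono) auto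
  also have "\<dots> \<le> (\<Sum>b\<in>UNIV. card (\<Union>k<L. \<Union>z\<in>S b k. W b k z))"
    by (rule card_UN_le) simp
  also have "\<dots> \<le> (\<Sum>b\<in>UNIV. \<Sum>k<L. card (\<Union>z\<in>S b k. W b k z))"
    by (intro sum_mono card_UN_le) simp
  also have "\<dots> \<le> (\<Sum>b\<in>UNIV. \<Sum>k<L. \<Sum>z\<in>S b k. card (W b k z))"
    by (intro sum_mono card_UN_le finS)
  also have "\<dots> \<le> (\<Sum>b\<in>UNIV. \<Sum>k<L. \<Sum>z\<in>S b k. N)"
    by (intro sum_mono W)
  also have "\<dots> = (\<Sum>b\<in>UNIV. \<Sum>k<L. N * card (S b k))"
    by (simp add: mult.commute)
  finally have "t * card ?Bad \<le> t * (\<Sum>b\<in>UNIV. \<Sum>k<L. N * card (S b k))"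
    by (rule mult_le_mono2)
  also have "\<dots> = N * (\<Sum>b\<in>UNIV. t * (\<Sum>k<L. card (S b k)))"
    by (simp add: sum_distrib_left mult.left_commute)
  also have "\<dots> \<le> N * (\<Sum>b\<in>(UNIV :: ('d \<Rightarrow> bool) set). a * card V)"
    unfolding S_def by (intro mult_le_mono2 sum_mono card_supported_cells_le V)
      (unfold \<pi>_def, rule grid_cell_nested)
  also have "\<dots> = N * 2 ^ CARD('d) * (a * card V)"
    by (simp add: card_fun)
  finally show ?thesis .
qed

section \<open>Logarithmic metrics\<close>

text \<open>One step outwards from distance \<open>x\<close> to \<open>y\<close>, charged to the
  point left behind by \<open>ln s \<le> s - 1\<close>. Truncation at \<open>\<kappa>\<close> stops
  the charge beyond that distance.\<close>

lemma ln_min_step: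
  fixes x y :: real
  assumes x: "0 < x" and y: "0 < y" and \<kappa>: "0 < \<kappa>" and step: "y \<le> x + a"
  shows "ln (min y \<kappa>) - ln (min x \<kappa>) \<le> (if x \<le> \<kappa> then max 0 (a / x) else 0)"
proof (cases "x \<le> \<kappa> \<and> x \<le> y")
  case True
  have "ln (min y \<kappa>) - ln (min x \<kappa>) \<le> ln y - ln x"
    using True x y \<kappa> by simp
  also have "\<dots> = ln (y / x)" using x y by (simp add: ln_div)
  also have "\<dots> \<le> y / x - 1" using x y by (intro ln_le_minus_one) simp
  also have "\<dots> = (y - x) / x" using x by (simp add: diff_divide_distrib)
  also have "\<dots> \<le> a / x" using x step by (intro divide_right_mono) auto
  finally show ?thesis using True by simp
next
  case False
  then have "min y \<kappa> \<le> min x \<kappa>" by auto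
  then have "ln (min y \<kappa>) - ln (min x \<kappa>) \<le> 0" using x y \<kappa> by simp
  then show ?thesis by (rule order_trans) simp
qed

text \<open>One step inwards from distance \<open>x\<close> to \<open>y\<close>, charged to the
  point reached. Because \<open>x \<le> B * y\<close>, a point with \<open>y < \<kappa> / B\<close>
  forces \<open>x < \<kappa>\<close>, so both values are clamped to \<open>\<kappa>\<close> and no
  charge arises.\<close>

lemma ln_clamp_step:
  fixes x y :: real
  assumes y: "0 < y" and \<kappa>: "0 < \<kappa>" "\<kappa> \<le> R" and step: "x \<le> y + a" "x \<le> B * y" and B: "0 < B"
  shows "ln (max \<kappa> (min x R)) - ln (max \<kappa> (min y R)) \<le> (if \<kappa> / B \<le> y \<and> y \<le> R then max 0 (a / y) else 0)"
proof -
  consider "x \<le> y" | "R \<le> y" "y < x" | "y < \<kappa> / B" "y < x" | "\<kappa> / B \<le> y" "y < R" "y < x" by linarith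
  then show ?thesis
  proof cases
    case 1
    then have "max \<kappa> (min x R) \<le> max \<kappa> (min y R)" by auto
    then have "ln (max \<kappa> (min x R)) - ln (max \<kappa> (min y R)) \<le> 0" using \<kappa> by (simp add: less_max_iff_disj)
    then show ?thesis by (rule order_trans) simp
  next
    case 2
    then have "max \<kappa> (min x R) = max \<kappa> (min y R)" by auto
    then show ?thesis by (simp split: if_splits)
  next
    case 3
    have "x < \<kappa>" using 3 B step(2) by (simp add: field_simps)
    then have "max \<kappa> (min x R) = max \<kappa> (min y R)" using 3 by auto
    then show ?thesis by (simp split: if_splits)
  next
    case 4
    have "max \<kappa> (min x R) * y \<le> max \<kappa> (min y R) * x"
    proof -
      have "max \<kappa> (min x R) * y \<le> max \<kappa> x * y" using y by (intro mult_right_mono) auto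
      also have "\<dots> \<le> max \<kappa> y * x"
        using 4 y \<kappa> by (auto simp: max_def mult.commute intro: mult_mono)
      finally show ?thesis using 4 by (simp add: min_def)
    qed
    then have "max \<kappa> (min x R) \<le> max \<kappa> (min y R) * (x / y)"
      unfolding times_divide_eq_right pos_le_divide_eq[OF y] .
    moreover have "0 < max \<kappa> (min x R)" "0 < max \<kappa> (min y R)" using \<kappa> by (auto simp: less_max_iff_disj)
    ultimately have "ln (max \<kappa> (min x R)) \<le> ln (max \<kappa> (min y R) * (x / y))"
      using y 4 by (subst ln_le_cancel_iff) (auto intro!: mult_pos_pos)
    also have "\<dots> = ln (max \<kappa> (min y R)) + ln (x / y)"
      using y 4 \<open>0 < max \<kappa> (min y R)\<close> by (subst ln_mult) auto
    also have "ln (x / y) \<le> x / y - 1" using y 4 by (intro ln_le_minus_one) simp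
    also have "\<dots> = (x - y) / y" using y by (simp add: diff_divide_distrib)
    also have "\<dots> \<le> a / y" using y step by (intro divide_right_mono) auto
    finally show ?thesis using 4 by simp
  qed
qed

lemma power_add_le:
  fixes a b :: real
  assumes "0 \<le> a" "0 \<le> b"
  shows "(a + b) ^ d \<le> 2 ^ d * (a ^ d + b ^ d)"
proof -
  have "(a + b) ^ d \<le> (2 * max a b) ^ d" using assms by (intro power_mono) auto
  also have "\<dots> = 2 ^ d * max a b ^ d" by (simp add: power_mult_distrib)
  also have "max a b ^ d \<le> a ^ d + b ^ d" using assms by (auto simp: max_def)
  finally show ?thesis by simp
qed

section \<open>Energy and crossing lengths in a finite packing\<close>

text \<open>A packing indexed by the vertices of the graph, with disjointness of interiors restated
  as separation of centres.\<close>

locale uniform_tangency =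
  fixes c :: "'v \<Rightarrow> 'a::euclidean_space" and r :: "'v \<Rightarrow> real" and M :: real
    and V :: "'v set" and E :: "'v \<Rightarrow> 'v \<Rightarrow> bool"
  assumes finite_V: "finite V" and r_pos: "u \<in> V \<Longrightarrow> 0 < r u" and M_nonneg: "0 \<le> M"
    and sep: "u \<in> V \<Longrightarrow> w \<in> V \<Longrightarrow> u \<noteq> w \<Longrightarrow> r u + r w \<le> dist (c u) (c w)"
    and edge: "E u w \<Longrightarrow> u \<in> V \<and> w \<in> V \<and> dist (c u) (c w) = r u + r w \<and> r u \<le> M * r w \<and> r w \<le> M * r u"
begin

lemma r_le_dist:
  assumes "x \<in> V" "u \<in> V" "u \<noteq> x"
  shows "r u \<le> dist (c x) (c u)" "r x \<le> dist (c x) (c u)" "0 < dist (c x) (c u)"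
proof -
  have "r x + r u \<le> dist (c x) (c u)" "0 < r x" "0 < r u" using assms sep[of x u] r_pos by auto
  then show "r u \<le> dist (c x) (c u)" "r x \<le> dist (c x) (c u)" "0 < dist (c x) (c u)" by linarith+
qed

text \<open>An edge has length \<open>r u + r w\<close>, at most \<open>1 + M\<close> times the
  radius at either end, so a step may be charged to whichever end is convenient.\<close>

lemma edge_dist_le:
  assumes "E u w"
  shows "dist (c x) (c u) \<le> dist (c x) (c w) + (1 + M) * r w"
    "dist (c x) (c w) \<le> dist (c x) (c u) + (1 + M) * r u"
proof -
  have "dist (c x) (c u) \<le> dist (c x) (c w) + dist (c u) (c w)" by (metis dist_commute dist_triangle)
  moreover have "dist (c x) (c w) \<le> dist (c x) (c u) + dist (c u) (c w)" by (metis dist_triangle)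
  ultimately show "dist (c x) (c u) \<le> dist (c x) (c w) + (1 + M) * r w"
    "dist (c x) (c w) \<le> dist (c x) (c u) + (1 + M) * r u"
    using edge[OF assms] by (auto simp: algebra_simps)
qed

text \<open>The distances from \<open>\<alpha>\<close> to \<open>\<beta>\<close> are covered by
  \<open>n\<close> dyadic annuli. The centre \<open>x\<close> is kept apart, because the radial
  formula makes no sense at distance 0.\<close>

lemma sum_radial_le:
  assumes "x \<in> V" "0 < \<alpha>" "2 ^ n * \<alpha> > \<beta>"
    and m: "\<And>u. u \<in> V \<Longrightarrow> u \<noteq> x \<Longrightarrow> \<alpha> \<le> dist (c x) (c u) \<Longrightarrow> dist (c x) (c u) \<le> \<beta> \<Longrightarrow>
       m u = (1 + M) * (r u / dist (c x) (c u))"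
    and m0: "\<And>u. u \<in> V \<Longrightarrow> u \<noteq> x \<Longrightarrow> \<not> (\<alpha> \<le> dist (c x) (c u) \<and> dist (c x) (c u) \<le> \<beta>) \<Longrightarrow> m u = 0"
  shows "(\<Sum>u\<in>V. m u ^ DIM('a)) \<le> m x ^ DIM('a) + (1 + M) ^ DIM('a) * (real n * 4 ^ DIM('a))"
proof -
  define I where "I = {u\<in>V. u \<noteq> x \<and> \<alpha> \<le> dist (c x) (c u) \<and> dist (c x) (c u) \<le> \<beta>}"
  have I: "finite I" using finite_V by (simp add: I_def)
  have "(\<Sum>u\<in>V. m u ^ DIM('a)) = m x ^ DIM('a) + (\<Sum>u\<in>V - {x}. m u ^ DIM('a))"
    using assms(1) finite_V by (simp add: sum.remove)
  also have "(\<Sum>u\<in>V - {x}. m u ^ DIM('a)) = (\<Sum>u\<in>I. m u ^ DIM('a))"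
    using finite_V m0 by (intro sum.mono_neutral_right) (auto simp: I_def)
  also have "\<dots> = (\<Sum>u\<in>I. (1 + M) ^ DIM('a) * (r u / dist (c x) (c u)) ^ DIM('a))"
    using m by (intro sum.cong refl) (simp add: I_def power_mult_distrib power_divide)
  also have "\<dots> = (1 + M) ^ DIM('a) * (\<Sum>u\<in>I. (r u / dist (c x) (c u)) ^ DIM('a))"
    by (simp add: sum_distrib_left)
  also have "(\<Sum>u\<in>I. (r u / dist (c x) (c u)) ^ DIM('a)) \<le> real n * 4 ^ DIM('a)"
  proof (rule sum_annulus_le[OF I, where \<alpha> = \<alpha>])
    fix u assume u: "u \<in> I"
    show "0 < r u" using u r_pos by (simp add: I_def)
    show "r u \<le> dist (c x) (c u)"
      using u assms(1) by (auto simp: I_def intro: r_le_dist)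
    show "dist (c x) (c u) < 2 ^ n * \<alpha>" "\<alpha> \<le> dist (c x) (c u)" using u assms(3) by (auto simp: I_def)
    show "r u + r w \<le> dist (c u) (c w)" if "w \<in> I" "u \<noteq> w" for w
      using u that sep[of u w] by (simp add: I_def)
  qed (use assms in auto)
  finally show ?thesis using M_nonneg by (simp add: mult_left_mono)
qed

text \<open>The logarithm of the distance to \<open>v\<close>, truncated at \<open>K * r v\<close>,
  is telescoped from the first neighbour on the path to the vertex outside. The neighbour is at
  distance at most \<open>(1 + M) * r v\<close>, which costs the term
  \<open>ln (1 + M)\<close>.\<close>

lemma outward_length_ge:
  assumes v: "v \<in> V" and K: "1 \<le> K"
    and m0: "\<And>u. 0 \<le> m u"
    and m: "\<And>u. u \<in> V \<Longrightarrow> u \<noteq> v \<Longrightarrow> dist (c v) (c u) \<le> K * r v \<Longrightarrow>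
       (1 + M) * (r u / dist (c v) (c u)) \<le> m u"
    and \<gamma>: "\<gamma> 0 = v" "inj_on \<gamma> {..R}" "\<And>i. i < R \<Longrightarrow> E (\<gamma> i) (\<gamma> (Suc i))"
    and j: "j \<le> R" "K * r v < dist (c v) (c (\<gamma> j))"
  shows "ln K - ln (1 + M) \<le> (\<Sum>i\<le>R. m (\<gamma> i))"
proof -
  define \<rho> where "\<rho> i = dist (c v) (c (\<gamma> i))" for i
  \<comment> \<open>The index is shifted because \<open>\<rho> 0 = 0\<close>; injectivity keeps all
    later distances positive.\<close>
  define f where "f i = ln (min (\<rho> (Suc i)) (K * r v))" for i
  have rv: "0 < r v" using r_pos v .
  have "0 < K * r v" using K rv by simp
  then have "j \<noteq> 0" using j \<gamma>(1) by (metis dist_self less_asym)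
  then obtain l where l: "j = Suc l" by (cases j) auto
  have ne: "\<gamma> i \<noteq> v" if "0 < i" "i \<le> R" for i
    using \<gamma>(1,2) that by (auto dest: inj_onD[of _ _ i 0])
  have in_V: "\<gamma> i \<in> V" if "0 < i" "i \<le> R" for i
    using edge[OF \<gamma>(3)[of "i - 1"]] that by simp
  have pos: "0 < \<rho> i" if "0 < i" "i \<le> R" for i
    unfolding \<rho>_def by (rule r_le_dist(3)[OF v in_V[OF that] ne[OF that]])
  have step: "f (Suc i) - f i \<le> m (\<gamma> (Suc i))" if "i < l" for i
  proof -
    have i: "0 < Suc i" "Suc i \<le> R" "Suc (Suc i) \<le> R" using that l j by auto
    have "f (Suc i) - f i \<le> (if \<rho> (Suc i) \<le> K * r v then max 0 ((1 + M) * r (\<gamma> (Suc i)) / \<rho> (Suc i)) else 0)"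
      unfolding f_def
    proof (rule ln_min_step)
      show "\<rho> (Suc (Suc i)) \<le> \<rho> (Suc i) + (1 + M) * r (\<gamma> (Suc i))"
        unfolding \<rho>_def using \<gamma>(3) i by (intro edge_dist_le) simp
    qed (use pos i K rv in auto)
    also have "\<dots> \<le> m (\<gamma> (Suc i))"
      using m[OF in_V[OF i(1,2)] ne[OF i(1,2)]] m0 by (simp add: \<rho>_def)
    finally show ?thesis .
  qed
  have "\<rho> (Suc 0) \<le> (1 + M) * r v"
    using edge[OF \<gamma>(3)[of 0]] l j \<gamma>(1) by (simp add: \<rho>_def algebra_simps)
  then have "f 0 \<le> ln ((1 + M) * r v)"
    unfolding f_def using pos[of "Suc 0"] rv K l j by (subst ln_le_cancel_iff) auto
  moreover have "f l = ln (K * r v)" using j by (simp add: f_def \<rho>_def l min_def)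
  moreover have "f l - f 0 \<le> (\<Sum>i<l. m (\<gamma> (Suc i)))"
    unfolding sum_lessThan_telescope[symmetric] by (rule sum_mono) (use step in auto)
  moreover have "(\<Sum>i<l. m (\<gamma> (Suc i))) \<le> (\<Sum>i\<le>R. m (\<gamma> i))"
  proof -
    have "(\<Sum>i<l. m (\<gamma> (Suc i))) = (\<Sum>i\<in>Suc ` {..<l}. m (\<gamma> i))" by (simp add: sum.reindex)
    also have "\<dots> \<le> (\<Sum>i\<le>R. m (\<gamma> i))" using l j m0 by (intro sum_mono2) auto
    finally show ?thesis .
  qed
  ultimately show ?thesis using rv K M_nonneg by (simp add: ln_mult)
qed

text \<open>The logarithm of the distance to \<open>q\<close>, clamped between
  \<open>r v / K\<close> and \<open>r v\<close>, falls by \<open>ln K\<close> along the path, and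
  every step is paid for by the vertex it reaches.\<close>

lemma inward_length_ge:
  assumes v: "v \<in> V" and q: "q \<in> V" "r q < r v / K" and K: "1 \<le> K"
    and m0: "\<And>u. 0 \<le> m u" and mq: "1 + M \<le> m q"
    and m: "\<And>u. u \<in> V \<Longrightarrow> u \<noteq> q \<Longrightarrow> r v / (K * (2 + M)) \<le> dist (c q) (c u) \<Longrightarrow>
       dist (c q) (c u) \<le> r v \<Longrightarrow> (1 + M) * (r u / dist (c q) (c u)) \<le> m u"
    and \<gamma>: "\<gamma> 0 = v" "\<And>i. i < R \<Longrightarrow> E (\<gamma> i) (\<gamma> (Suc i))"
    and j: "j \<le> R" "dist (c q) (c (\<gamma> j)) \<le> r v / K"
  shows "ln K \<le> (\<Sum>i\<le>R. m (\<gamma> i))"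
proof -
  define \<rho> where "\<rho> i = dist (c q) (c (\<gamma> i))" for i
  define \<kappa> where "\<kappa> = r v / K"
  have rv: "0 < r v" and rq: "0 < r q" using r_pos v q by auto
  have \<kappa>: "0 < \<kappa>" "\<kappa> \<le> r v" using K rv by (auto simp: \<kappa>_def divide_le_eq)
  define f where "f i = ln (max \<kappa> (min (\<rho> i) (r v)))" for i
  have step: "f i - f (Suc i) \<le> m (\<gamma> (Suc i))" if i: "i < R" for i
  proof -
    have e: "E (\<gamma> i) (\<gamma> (Suc i))" using \<gamma>(2) i .
    note ed = edge[OF e]
    show ?thesis
    \<comment> \<open>A step onto \<open>q\<close> has no radial charge. Neighbours of
      \<open>q\<close> are within \<open>(1 + M) * r q\<close> of it, so such a step lowers
      \<open>f\<close> by at most \<open>ln (1 + M)\<close>, which the weight of \<open>q\<close>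
      covers.\<close>
    proof (cases "\<gamma> (Suc i) = q")
      case True
      have "\<rho> i \<le> (1 + M) * r q" using ed True by (simp add: \<rho>_def dist_commute algebra_simps)
      also have "\<dots> \<le> (1 + M) * \<kappa>" using q M_nonneg by (intro mult_left_mono) (auto simp: \<kappa>_def)
      finally have "max \<kappa> (min (\<rho> i) (r v)) \<le> (1 + M) * \<kappa>"
        using M_nonneg \<kappa> by (auto simp: algebra_simps)
      then have "f i \<le> ln ((1 + M) * \<kappa>)"
        unfolding f_def using \<kappa> M_nonneg by (subst ln_le_cancel_iff) (auto simp: less_max_iff_disj)
      also have "\<dots> = ln (1 + M) + ln \<kappa>" using \<kappa> M_nonneg by (simp add: ln_mult)
      also have "ln (1 + M) \<le> 1 + M" using M_nonneg ln_le_minus_one[of "1 + M"] by simp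
      finally have "f i \<le> m q + ln \<kappa>" using mq by simp
      moreover have "f (Suc i) = ln \<kappa>" using True \<kappa> rv by (simp add: f_def \<rho>_def)
      ultimately show ?thesis using True by simp
    next
      case False
      have w: "r (\<gamma> (Suc i)) \<le> \<rho> (Suc i)" "0 < r (\<gamma> (Suc i))"
        using r_le_dist(1)[of q "\<gamma> (Suc i)"] ed False q r_pos by (auto simp: \<rho>_def)
      \<comment> \<open>The radius at the vertex reached is at most its distance to
        \<open>q\<close>, so one edge divides that distance by at most \<open>2 + M\<close>. This is
        why the weight must extend down to \<open>r v / (K * (2 + M))\<close>.\<close>
      have 1: "\<rho> i \<le> \<rho> (Suc i) + (1 + M) * r (\<gamma> (Suc i))"
        unfolding \<rho>_def by (rule edge_dist_le(1)[OF e])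
      also have "\<dots> \<le> \<rho> (Suc i) + (1 + M) * \<rho> (Suc i)" using w M_nonneg by (intro add_left_mono mult_left_mono) auto
      finally have 2: "\<rho> i \<le> (2 + M) * \<rho> (Suc i)" by (simp add: algebra_simps)
      have "f i - f (Suc i) \<le> (if \<kappa> / (2 + M) \<le> \<rho> (Suc i) \<and> \<rho> (Suc i) \<le> r v
         then max 0 ((1 + M) * r (\<gamma> (Suc i)) / \<rho> (Suc i)) else 0)"
        unfolding f_def using w \<kappa> 1 2 M_nonneg by (intro ln_clamp_step) auto
      also have "\<dots> \<le> m (\<gamma> (Suc i))"
        using m[of "\<gamma> (Suc i)"] ed False m0 by (simp add: \<rho>_def \<kappa>_def)
      finally show ?thesis .
    qed
  qed
  have "q \<noteq> v"
  proof
    assume "q = v"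
    then show False using q(2) \<kappa> by (simp add: \<kappa>_def)
  qed
  then have "r v \<le> \<rho> 0" using sep[of q v] v q rq \<gamma>(1) by (simp add: \<rho>_def)
  then have "f 0 = ln (r v)" using \<kappa> by (simp add: f_def)
  moreover have "f j = ln \<kappa>" using j \<kappa> by (simp add: f_def \<rho>_def \<kappa>_def)
  moreover have "ln (r v) - ln \<kappa> = ln K" using rv K by (simp add: \<kappa>_def ln_div)
  moreover have "f 0 - f j \<le> (\<Sum>i<j. m (\<gamma> (Suc i)))"
  proof -
    have "f 0 - f j = (\<Sum>i<j. f i - f (Suc i))" by (simp add: sum_lessThan_telescope')
    also have "\<dots> \<le> (\<Sum>i<j. m (\<gamma> (Suc i)))" by (rule sum_mono) (use step j in auto)
    finally show ?thesis .
  qed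
  moreover have "(\<Sum>i<j. m (\<gamma> (Suc i))) \<le> (\<Sum>i\<le>R. m (\<gamma> i))"
  proof -
    have "(\<Sum>i<j. m (\<gamma> (Suc i))) = (\<Sum>i\<in>Suc ` {..<j}. m (\<gamma> i))" by (simp add: sum.reindex)
    also have "\<dots> \<le> (\<Sum>i\<le>R. m (\<gamma> i))" using j m0 by (intro sum_mono2) auto
    finally show ?thesis .
  qed
  ultimately show ?thesis by linarith
qed

text \<open>
  A path with \<open>2 t + 1\<close> vertices must leave the ball of radius \<open>2 ^ n * r v\<close> around \<open>v\<close> or come
  within \<open>r v / 2 ^ n\<close> of \<open>q\<close> at a vertex other than \<open>q\<close>. Either way it crosses \<open>n\<close> dyadic annuli,
  and a logarithmic metric makes this costly.
\<close>

lemma clustering_metric: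
  assumes v: "v \<in> V" and q: "q \<in> V"
    and few: "card {u\<in>V. dist (c v) (c u) \<le> 2 ^ n * r v \<and> r v / 2 ^ n < dist (c q) (c u)} < 2 * t"
    and lam: "\<eta> = real n * ln 2 - ln (1 + M)" "0 < \<eta>" and b: "2 + M \<le> 2 ^ b"
    and \<epsilon>: "(2 * (1 + M) / \<eta>) ^ DIM('a) * (1 + real (2 * n + b + 2) * 4 ^ DIM('a)) \<le> \<epsilon>"
  shows "\<exists>m. (\<forall>u. 0 \<le> m u) \<and> (\<Sum>u\<in>V. m u ^ DIM('a)) \<le> \<epsilon> \<and>
    (\<forall>\<gamma>. \<gamma> 0 = v \<and> inj_on \<gamma> {..2 * t} \<and> (\<forall>i<2 * t. E (\<gamma> i) (\<gamma> (Suc i))) \<longrightarrow> 1 \<le> (\<Sum>i\<le>2 * t. m (\<gamma> i)))"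
proof -
  define K :: real where "K = 2 ^ n"
  have K: "1 \<le> K" by (simp add: K_def)
  have lnK: "ln K = real n * ln 2" by (simp add: K_def ln_realpow)
  have rv: "0 < r v" using r_pos v .
  let ?D = "DIM('a)"
  define m1 where "m1 u = (if u \<in> V \<and> u \<noteq> v \<and> dist (c v) (c u) \<le> K * r v
    then (1 + M) * (r u / dist (c v) (c u)) else 0)" for u
  \<comment> \<open>If \<open>r q\<close> is at least \<open>r v / K\<close>, no other centre is
    within \<open>r v / K\<close> of \<open>q\<close>, so an inward crossing cannot occur and the
    weight may vanish.\<close>
  define m2 where "m2 u = (if r v / K \<le> r q then 0 else if u = q then 1 + M
    else if u \<in> V \<and> r v / (K * (2 + M)) \<le> dist (c q) (c u) \<and> dist (c q) (c u) \<le> r v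
    then (1 + M) * (r u / dist (c q) (c u)) else 0)" for u
  have m1_nonneg: "0 \<le> m1 u" and m2_nonneg: "0 \<le> m2 u" for u
    using M_nonneg r_pos[of u] by (auto simp: m1_def m2_def)
  have m1: "(\<Sum>u\<in>V. m1 u ^ ?D) \<le> (1 + M) ^ ?D * (real (n + 1) * 4 ^ ?D)"
  proof -
    have "(\<Sum>u\<in>V. m1 u ^ ?D) \<le> m1 v ^ ?D + (1 + M) ^ ?D * (real (n + 1) * 4 ^ ?D)"
    proof (rule sum_radial_le[where \<alpha> = "r v" and \<beta> = "K * r v"])
      \<comment> \<open>The outer radius is exactly \<open>2 ^ n * r v\<close>; the extra annulus
        makes the inequality strict.\<close>
      show "K * r v < 2 ^ (n + 1) * r v" using rv by (simp add: K_def)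
      show "m1 u = 0" if "u \<in> V" "u \<noteq> v" "\<not> (r v \<le> dist (c v) (c u) \<and> dist (c v) (c u) \<le> K * r v)" for u
        using that sep[of v u] v r_pos[of u] by (simp add: m1_def)
    qed (use v rv in \<open>auto simp: m1_def\<close>)
    moreover have "m1 v ^ ?D = 0" by (simp add: m1_def)
    ultimately show ?thesis by simp
  qed
  have m2: "(\<Sum>u\<in>V. m2 u ^ ?D) \<le> (1 + M) ^ ?D * (1 + real (n + b + 1) * 4 ^ ?D)"
  proof (cases "r v / K \<le> r q")
    case True
    then have "(\<Sum>u\<in>V. m2 u ^ ?D) = 0" by (intro sum.neutral) (simp add: m2_def zero_power)
    then show ?thesis using M_nonneg by simp
  next
    case False
    have "(\<Sum>u\<in>V. m2 u ^ ?D) \<le> m2 q ^ ?D + (1 + M) ^ ?D * (real (n + b + 1) * 4 ^ ?D)"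
    proof (rule sum_radial_le[where \<alpha> = "r v / (K * (2 + M))" and \<beta> = "r v"])
      have "2 + M < 2 * 2 ^ b" using b M_nonneg by linarith
      then have "r v * (2 + M) < 2 * 2 ^ b * r v" using rv by simp
      then show "r v < 2 ^ (n + b + 1) * (r v / (K * (2 + M)))"
      proof -
        have "2 ^ (n + b + 1) * (r v / (K * (2 + M))) = 2 * 2 ^ b * r v / (2 + M)"
          by (simp add: K_def power_add)
        then show ?thesis
          using \<open>r v * (2 + M) < 2 * 2 ^ b * r v\<close> M_nonneg by (simp add: pos_less_divide_eq)
      qed
    qed (use q rv K M_nonneg False in \<open>auto simp: m2_def\<close>)
    then show ?thesis using False by (simp add: m2_def algebra_simps)
  qed
  \<comment> \<open>The outward crossing has length at least \<open>\<eta>\<close> and the inward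
    one at least \<open>ln K\<close>, which is no smaller; dividing by \<open>\<eta>\<close>
    normalises both to 1.\<close>
  define m where "m u = (m1 u + m2 u) / \<eta>" for u
  have "(\<Sum>u\<in>V. m u ^ ?D) = (\<Sum>u\<in>V. (m1 u + m2 u) ^ ?D) / \<eta> ^ ?D"
    by (simp add: m_def power_divide sum_divide_distrib)
  also have "\<dots> \<le> (2 ^ ?D * ((1 + M) ^ ?D * (1 + real (2 * n + b + 2) * 4 ^ ?D))) / \<eta> ^ ?D"
  proof (rule divide_right_mono)
    have "(\<Sum>u\<in>V. (m1 u + m2 u) ^ ?D) \<le> (\<Sum>u\<in>V. 2 ^ ?D * (m1 u ^ ?D + m2 u ^ ?D))"
      by (intro sum_mono power_add_le m1_nonneg m2_nonneg)
    also have "\<dots> = 2 ^ ?D * ((\<Sum>u\<in>V. m1 u ^ ?D) + (\<Sum>u\<in>V. m2 u ^ ?D))"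
      by (simp add: sum_distrib_left[symmetric] sum.distrib)
    also have "\<dots> \<le> 2 ^ ?D * ((1 + M) ^ ?D * (1 + real (2 * n + b + 2) * 4 ^ ?D))"
      using add_mono[OF m1 m2] by (intro mult_left_mono) (simp_all add: algebra_simps)
    finally show "(\<Sum>u\<in>V. (m1 u + m2 u) ^ ?D) \<le> \<dots>" .
  qed (use lam(2) in simp)
  also have "\<dots> = (2 * (1 + M) / \<eta>) ^ ?D * (1 + real (2 * n + b + 2) * 4 ^ ?D)"
    by (simp only: power_mult_distrib power_divide times_divide_eq_left mult.assoc)
  finally have sum: "(\<Sum>u\<in>V. m u ^ ?D) \<le> \<epsilon>" using \<epsilon> by linarith
  have long: "1 \<le> (\<Sum>i\<le>2 * t. m (\<gamma> i))"
    if \<gamma>: "\<gamma> 0 = v" "inj_on \<gamma> {..2 * t}" "\<And>i. i < 2 * t \<Longrightarrow> E (\<gamma> i) (\<gamma> (Suc i))" for \<gamma>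
  proof -
    define S where "S = {u\<in>V. dist (c v) (c u) \<le> K * r v \<and> r v / K < dist (c q) (c u)}"
    have S: "finite S" "card S < 2 * t" using finite_V few by (auto simp: S_def K_def)
    \<comment> \<open>An injective path visits \<open>2 * t + 1\<close> vertices, whereas
      \<open>insert q S\<close> has at most \<open>2 * t\<close>.\<close>
    have "card (insert q S) < card (\<gamma> ` {..2 * t})"
      using S card_insert_le_m1[of "2 * t" S q] \<gamma>(2) by (simp add: card_image card_insert_if)
    then have "\<not> \<gamma> ` {..2 * t} \<subseteq> insert q S" using S card_mono[of "insert q S"] by (auto simp: not_less[symmetric])
    then obtain j where j: "j \<le> 2 * t" "\<gamma> j \<noteq> q" "\<gamma> j \<notin> S" by auto
    have jV: "\<gamma> j \<in> V" using edge[OF \<gamma>(3)[of "j - 1"]] j(1) v \<gamma>(1) by (cases j) auto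
    have "\<eta> \<le> (\<Sum>i\<le>2 * t. m1 (\<gamma> i) + m2 (\<gamma> i))"
    proof (cases "K * r v < dist (c v) (c (\<gamma> j))")
      case True
      have "ln K - ln (1 + M) \<le> (\<Sum>i\<le>2 * t. m1 (\<gamma> i) + m2 (\<gamma> i))"
        using True \<gamma> j(1) m1_nonneg m2_nonneg
        by (intro outward_length_ge[OF v K, of "\<lambda>u. m1 u + m2 u"]) (auto simp: m1_def)
      then show ?thesis by (simp add: lam lnK)
    next
      case False
      then have close: "dist (c q) (c (\<gamma> j)) \<le> r v / K" using j jV by (auto simp: S_def)
      then have rq: "r q < r v / K"
        using sep[OF q jV] j(2) r_pos[OF jV] by simp
      have "ln K \<le> (\<Sum>i\<le>2 * t. m1 (\<gamma> i) + m2 (\<gamma> i))"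
        using rq m1_nonneg m2_nonneg
        by (intro inward_length_ge[OF v q rq K, of "\<lambda>u. m1 u + m2 u", OF _ _ _ \<gamma>(1,3) j(1) close])
          (auto simp: m2_def)
      moreover have "0 \<le> ln (1 + M)" using M_nonneg by simp
      ultimately show ?thesis by (simp add: lam lnK)
    qed
    then show ?thesis using lam(2) by (simp add: m_def sum_divide_distrib[symmetric])
  qed
  show ?thesis
  proof (intro exI[of _ m] conjI allI impI)
    show "0 \<le> m u" for u using m1_nonneg[of u] m2_nonneg[of u] lam(2) by (simp add: m_def)
  qed (use sum long in auto)
qed

end

section \<open>Cheap rooted graphs\<close>

definition cheap_cut :: "nat \<Rightarrow> real \<Rightarrow> nat \<Rightarrow> 'v ugraph \<times> 'v \<Rightarrow> bool" where
  "cheap_cut d \<epsilon> R p \<longleftrightarrow> (\<exists>m. (\<forall>u. 0 \<le> m u) \<and> (\<Sum>u\<in>ball_verts (fst p) (snd p) R. m u ^ d) \<le> \<epsilon> \<and>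
     (\<forall>\<gamma>. \<gamma> 0 = snd p \<and> inj_on \<gamma> {..R} \<and> (\<forall>i<R. {\<gamma> i, \<gamma> (Suc i)} \<in> edges (fst p)) \<longrightarrow>
        1 \<le> (\<Sum>i\<le>R. m (\<gamma> i))))"

lemma path_in_ball:
  assumes p: "is_rooted_graph p" and "\<gamma> 0 = snd p"
    and "\<And>i. i < R \<Longrightarrow> {\<gamma> i, \<gamma> (Suc i)} \<in> edges (fst p)" and "i \<le> R"
  shows "\<gamma> i \<in> ball_verts (fst p) (snd p) R"
proof -
  have "\<gamma> i \<in> ball_verts (fst p) (snd p) i"
    using \<open>i \<le> R\<close>
  proof (induction i)
    case 0
    then show ?case using ball_verts_0[OF p] assms(2) by simp
  next
    case (Suc i)
    then show ?case using ball_verts_Suc[OF p, of i] assms(3)[of i] by auto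
  qed
  then show ?thesis using ball_verts_mono[OF \<open>i \<le> R\<close>, of "fst p" "snd p"] by blast
qed

text \<open>The weight is pulled back along the isomorphism of balls. Paths with \<open>R\<close>
  edges from the root stay in the ball, so they are carried to paths of the other graph.\<close>

lemma cheap_cut_local:
  assumes p: "is_rooted_graph p" and q: "is_rooted_graph q"
    and R: "R \<in> iso_depths p q" and cheap: "cheap_cut d \<epsilon> R p"
  shows "cheap_cut d \<epsilon> R q"
proof -
  from R iso_depths_sym[OF p q] obtain f where f: "ball_iso_map f q p R"
    unfolding iso_depths_iff[symmetric] by (metis iso_depths_iff)
  let ?B = "ball_verts (fst q) (snd q) R"
  from f have bij: "bij_betw f ?B (ball_verts (fst p) (snd p) R)" and root: "f (snd q) = snd p"
    and edge: "\<And>u v. u \<in> ?B \<Longrightarrow> v \<in> ?B \<Longrightarrow> {u, v} \<in> edges (fst q) \<Longrightarrow> {f u, f v} \<in> edges (fst p)"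
    by (auto simp: ball_iso_map_iff)
  from cheap obtain m where m: "\<And>u. 0 \<le> m u" "(\<Sum>u\<in>ball_verts (fst p) (snd p) R. m u ^ d) \<le> \<epsilon>"
    "\<And>\<gamma>. \<gamma> 0 = snd p \<Longrightarrow> inj_on \<gamma> {..R} \<Longrightarrow> (\<And>i. i < R \<Longrightarrow> {\<gamma> i, \<gamma> (Suc i)} \<in> edges (fst p)) \<Longrightarrow>
        1 \<le> (\<Sum>i\<le>R. m (\<gamma> i))"
    unfolding cheap_cut_def by blast
  show ?thesis
    unfolding cheap_cut_def
  proof (intro exI[of _ "m \<circ> f"] conjI allI impI)
    show "0 \<le> (m \<circ> f) u" for u using m(1) by simp
    show "(\<Sum>u\<in>?B. (m \<circ> f) u ^ d) \<le> \<epsilon>"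
      using m(2) sum.reindex_bij_betw[OF bij, of "\<lambda>u. m u ^ d"] by simp
    fix \<gamma> assume \<gamma>: "\<gamma> 0 = snd q \<and> inj_on \<gamma> {..R} \<and> (\<forall>i<R. {\<gamma> i, \<gamma> (Suc i)} \<in> edges (fst q))"
    then have B: "\<gamma> i \<in> ?B" if "i \<le> R" for i using path_in_ball[OF q] that by blast
    have "1 \<le> (\<Sum>i\<le>R. m ((f \<circ> \<gamma>) i))"
    proof (rule m(3))
      show "(f \<circ> \<gamma>) 0 = snd p" using \<gamma> root by simp
      have "inj_on f (\<gamma> ` {..R})" using bij B by (auto simp: bij_betw_def intro: inj_on_subset)
      then show "inj_on (f \<circ> \<gamma>) {..R}" using \<gamma> by (intro comp_inj_on) auto
      show "{(f \<circ> \<gamma>) i, (f \<circ> \<gamma>) (Suc i)} \<in> edges (fst p)" if "i < R" for i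
        using \<gamma> B that by (auto intro!: edge)
    qed
    then show "1 \<le> (\<Sum>i\<le>R. (m \<circ> f) (\<gamma> i))" by simp
  qed
qed

lemma cheap_cut_cong:
  assumes "is_rooted_graph p" "is_rooted_graph q" "R \<in> iso_depths p q"
  shows "cheap_cut d \<epsilon> R p \<longleftrightarrow> cheap_cut d \<epsilon> R q"
  using cheap_cut_local[OF assms] cheap_cut_local[OF assms(2,1)] assms(3) iso_depths_sym[OF assms(1,2)]
  by blast

section \<open>Cheapness of most vertices in finite uniform graphs\<close>

text \<open>Once the base of the power is at most 1, the exponent \<open>d\<close> may be lowered to
  2, and what remains is of order \<open>1 / n\<close>.\<close>

lemma logarithmic_scale_exists:
  fixes M \<epsilon> C b :: real
  assumes M: "0 \<le> M" and \<epsilon>: "0 < \<epsilon>" and C: "0 < C" and d: "2 \<le> d" and b: "0 \<le> b"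
  shows "\<exists>n. 0 < real n * ln 2 - ln (1 + M) \<and>
    (2 * (1 + M) / (real n * ln 2 - ln (1 + M))) ^ d * (1 + (2 * real n + b + 2) * C) \<le> \<epsilon>"
proof -
  define A where "A = 2 * (1 + M)"
  have A: "0 < A" using M by (simp add: A_def)
  define B where "B = ln (1 + M)"
  have "filterlim (\<lambda>n. real n * ln 2 - B) at_top sequentially" by real_asymp
  then have 1: "\<forall>\<^sub>F n in sequentially. A \<le> real n * ln 2 - B" by (simp add: filterlim_at_top)
  have "((\<lambda>n. (A / (real n * ln 2 - B)) ^ 2 * (1 + (2 * real n + b + 2) * C)) \<longlongrightarrow> 0) sequentially"
    using A C by real_asymp
  then have 2: "\<forall>\<^sub>F n in sequentially. (A / (real n * ln 2 - B)) ^ 2 * (1 + (2 * real n + b + 2) * C) < \<epsilon>"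
    using \<epsilon> by (rule order_tendstoD)
  obtain n where n: "A \<le> real n * ln 2 - B"
      "(A / (real n * ln 2 - B)) ^ 2 * (1 + (2 * real n + b + 2) * C) < \<epsilon>"
    using eventually_happens[OF eventually_conj[OF 1 2]] by auto
  have "A / (real n * ln 2 - B) \<le> 1" "0 \<le> A / (real n * ln 2 - B)" using n(1) A by auto
  then have "(A / (real n * ln 2 - B)) ^ d \<le> (A / (real n * ln 2 - B)) ^ 2"
    using d by (intro power_decreasing)
  then have "(A / (real n * ln 2 - B)) ^ d * (1 + (2 * real n + b + 2) * C)
      \<le> (A / (real n * ln 2 - B)) ^ 2 * (1 + (2 * real n + b + 2) * C)"
    using C b by (intro mult_right_mono) auto
  then show ?thesis using n A unfolding A_def B_def by (intro exI[of _ n]) linarith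
qed

text \<open>The balls are pulled back along the isomorphism. Tangency is symmetric, so the ratio
  bound applies in both orders.\<close>

lemma uniform_tangency_of_uniform_graph:
  fixes H :: "'v ugraph"
  assumes H: "simple_graph H" "finite (verts H)" and M: "0 \<le> M"
    and unif: "uniform_graph TYPE('a::euclidean_space) M H"
  shows "\<exists>(c :: 'v \<Rightarrow> 'a) r. uniform_tangency c r M (verts H) (\<lambda>u w. {u, w} \<in> edges H)"
proof -
  obtain U :: "'v set" and c :: "'v \<Rightarrow> 'a" and r where pack: "sphere_packing U c r" "uniform_packing M U c r"
    and iso: "graph_iso H (tangency_graph U c r)"
    using unif unfolding uniform_graph_def by blast
  from iso obtain f where f: "graph_iso_map f H (tangency_graph U c r)" unfolding graph_iso_def by blast
  then have bij: "bij_betw f (verts H) U" by (simp add: graph_iso_map_def tangency_graph_def)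
  then have fU: "f u \<in> U" if "u \<in> verts H" for u using that by (auto simp: bij_betw_def)
  have rpos: "0 < r (f u)" if "u \<in> verts H" for u using pack(1) fU[OF that] by (simp add: sphere_packing_def)
  have "uniform_tangency (c \<circ> f) (r \<circ> f) M (verts H) (\<lambda>u w. {u, w} \<in> edges H)"
  proof
    fix u w assume uw: "u \<in> verts H" "w \<in> verts H" "u \<noteq> w"
    then have "f u \<noteq> f w" using bij by (auto simp: bij_betw_def dest: inj_onD)
    then have "interior (cball (c (f u)) (r (f u))) \<inter> interior (cball (c (f w)) (r (f w))) = {}"
      using pack(1) fU uw unfolding sphere_packing_def by blast
    then show "(r \<circ> f) u + (r \<circ> f) w \<le> dist ((c \<circ> f) u) ((c \<circ> f) w)"
      using rpos uw by (simp add: dist_ge_of_disjoint_interiors)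
  next
    fix u w assume e: "{u, w} \<in> edges H"
    then have uw: "u \<in> verts H" "w \<in> verts H" using simple_graph_edgeD[OF H(1)] by blast+
    then have "{f u, f w} \<in> edges (tangency_graph U c r)" using f e by (simp add: graph_iso_map_def)
    then have tan: "tangent_balls c r (f u) (f w)"
      by (auto simp: tangency_graph_def tangent_balls_def doubleton_eq_iff dist_commute add.commute)
    then have "tangent_balls c r (f w) (f u)" by (simp add: tangent_balls_def dist_commute add.commute)
    with tan have "r (f u) / r (f w) \<le> M" "r (f w) / r (f u) \<le> M"
      using pack(2) fU uw unfolding uniform_packing_def by blast+
    then show "u \<in> verts H \<and> w \<in> verts H \<and> dist ((c \<circ> f) u) ((c \<circ> f) w) = (r \<circ> f) u + (r \<circ> f) w \<and>
        (r \<circ> f) u \<le> M * (r \<circ> f) w \<and> (r \<circ> f) w \<le> M * (r \<circ> f) u"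
      using tan uw rpos by (simp add: tangent_balls_def pos_divide_le_eq)
  qed (use H M rpos in auto)
  then show ?thesis by blast
qed

text \<open>A vertex that is not cheap cannot see the centres cluster, and the magic lemma counts
  such vertices. The depth \<open>R\<close> is fixed before \<open>H\<close>, which makes the
  estimate uniform over all finite graphs considered.\<close>

lemma card_not_cheap_cut_le:
  fixes M \<epsilon> \<delta> :: real
  assumes M: "0 \<le> M" and d: "2 \<le> CARD('d::finite)" and \<epsilon>: "0 < \<epsilon>" and \<delta>: "0 < \<delta>"
  shows "\<exists>R. \<forall>H :: 'v ugraph. simple_graph H \<longrightarrow> finite (verts H) \<longrightarrow> uniform_graph TYPE(real ^ 'd) M H \<longrightarrow>
    real (card {v\<in>verts H. \<not> cheap_cut CARD('d) \<epsilon> R (H, v)}) \<le> \<delta> * real (card (verts H))"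
proof -
  let ?d = "CARD('d)"
  obtain b where b: "2 + M < 2 ^ b" using real_arch_pow[of 2 "2 + M"] by auto
  obtain n where n: "0 < real n * ln 2 - ln (1 + M)"
    "(2 * (1 + M) / (real n * ln 2 - ln (1 + M))) ^ ?d * (1 + (2 * real n + real b + 2) * 4 ^ ?d) \<le> \<epsilon>"
    using logarithmic_scale_exists[OF M \<epsilon>, of "4 ^ ?d" ?d "real b"] d by auto
  define K :: real where "K = 2 ^ n"
  have K: "1 \<le> K" by (simp add: K_def)
  obtain a where a: "real ?d * 12 * K\<^sup>2 < 3 ^ a" using real_arch_pow[of 3 "real ?d * 12 * K\<^sup>2"] by auto
  obtain N where N: "(12 * K * (real ?d + 1)) ^ ?d \<le> real N" using real_arch_simple by blast
  \<comment> \<open>The magic lemma bounds the exceptional fraction by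
    \<open>N * 2 ^ ?d * a / t\<close>; this choice of \<open>t\<close> brings it below
    \<open>\<delta>\<close>.\<close>
  obtain t where t: "real (N * 2 ^ ?d * a) / \<delta> < real t" using reals_Archimedean2 by blast
  have t0: "0 < t"
  proof (rule ccontr)
    assume "\<not> 0 < t"
    then have "real (N * 2 ^ ?d * a) / \<delta> < 0" using t by simp
    moreover have "0 \<le> real (N * 2 ^ ?d * a) / \<delta>" using \<delta> by (intro divide_nonneg_pos) auto
    ultimately show False by linarith
  qed
  have "real (card {v\<in>verts H. \<not> cheap_cut ?d \<epsilon> (2 * t) (H, v)}) \<le> \<delta> * real (card (verts H))"
    if H: "simple_graph H" "finite (verts H)" and unif: "uniform_graph TYPE(real ^ 'd) M H" for H :: "'v ugraph"
  proof -
    obtain c :: "'v \<Rightarrow> real ^ 'd" and r where "uniform_tangency c r M (verts H) (\<lambda>u w. {u, w} \<in> edges H)"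
      using uniform_tangency_of_uniform_graph[OF H M unif] by blast
    then interpret uniform_tangency c r M "verts H" "\<lambda>u w. {u, w} \<in> edges H" .
    let ?Bad = "{v\<in>verts H. \<forall>q\<in>verts H.
      2 * t \<le> card {u\<in>verts H. dist (c v) (c u) \<le> K * r v \<and> r v / K < dist (c q) (c u)}}"
    have "{v\<in>verts H. \<not> cheap_cut ?d \<epsilon> (2 * t) (H, v)} \<subseteq> ?Bad"
    proof
      fix v assume "v \<in> {v\<in>verts H. \<not> cheap_cut ?d \<epsilon> (2 * t) (H, v)}"
      then have v: "v \<in> verts H" "\<not> cheap_cut ?d \<epsilon> (2 * t) (H, v)" by auto
      have "cheap_cut ?d \<epsilon> (2 * t) (H, v)" if q: "q \<in> verts H"
        "card {u\<in>verts H. dist (c v) (c u) \<le> K * r v \<and> r v / K < dist (c q) (c u)} < 2 * t" for q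
      proof -
        have "\<exists>m. (\<forall>u. 0 \<le> m u) \<and> (\<Sum>u\<in>verts H. m u ^ DIM(real ^ 'd)) \<le> \<epsilon> \<and>
          (\<forall>\<gamma>. \<gamma> 0 = v \<and> inj_on \<gamma> {..2 * t} \<and> (\<forall>i<2 * t. {\<gamma> i, \<gamma> (Suc i)} \<in> edges H) \<longrightarrow>
            1 \<le> (\<Sum>i\<le>2 * t. m (\<gamma> i)))"
          using n q b unfolding K_def
          by (intro clustering_metric[OF v(1) q(1), where n = n and b = b and t = t and \<eta> = "real n * ln 2 - ln (1 + M)"])
            (simp_all add: add_ac)
        then obtain m where m: "\<forall>u. 0 \<le> m u" "(\<Sum>u\<in>verts H. m u ^ ?d) \<le> \<epsilon>"
          "\<forall>\<gamma>. \<gamma> 0 = v \<and> inj_on \<gamma> {..2 * t} \<and> (\<forall>i<2 * t. {\<gamma> i, \<gamma> (Suc i)} \<in> edges H) \<longrightarrow>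
            1 \<le> (\<Sum>i\<le>2 * t. m (\<gamma> i))" by auto
        have "(\<Sum>u\<in>ball_verts H v (2 * t). m u ^ ?d) \<le> (\<Sum>u\<in>verts H. m u ^ ?d)"
          using m(1) H(2) by (intro sum_mono2) (auto simp: ball_verts_def)
        then show ?thesis using m unfolding cheap_cut_def by (intro exI[of _ m]) auto
      qed
      then show "v \<in> ?Bad" using v by (auto simp: not_less[symmetric])
    qed
    then have "card {v\<in>verts H. \<not> cheap_cut ?d \<epsilon> (2 * t) (H, v)} \<le> card ?Bad"
      using H by (intro card_mono) auto
    then have "t * card {v\<in>verts H. \<not> cheap_cut ?d \<epsilon> (2 * t) (H, v)} \<le> t * card ?Bad" by simp
    also have "\<dots> \<le> N * 2 ^ ?d * (a * card (verts H))"
      using a by (intro card_non_clustering_le[OF H(2) r_pos sep K _ N]) auto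
    finally have "real (t * card {v\<in>verts H. \<not> cheap_cut ?d \<epsilon> (2 * t) (H, v)})
        \<le> real (N * 2 ^ ?d * (a * card (verts H)))" by (rule of_nat_mono)
    also have "\<dots> = real (N * 2 ^ ?d * a) * real (card (verts H))" by simp
    also have "\<dots> \<le> real t * \<delta> * real (card (verts H))"
      using t \<delta> by (intro mult_right_mono) (auto simp: pos_divide_less_eq)
    finally have "real t * real (card {v\<in>verts H. \<not> cheap_cut ?d \<epsilon> (2 * t) (H, v)})
        \<le> real t * (\<delta> * real (card (verts H)))" by (simp add: mult.assoc)
    then show ?thesis using t0 by simp
  qed
  then show ?thesis by blast
qed

section \<open>Parabolicity\<close>

text \<open>A certificate for infinite extremal length at \<open>v\<close>. Finite support and real
  weights keep infinite sums and \<open>ennreal\<close> out of the combinatorial arguments.\<close>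

definition rays_expensive :: "nat \<Rightarrow> 'v ugraph \<Rightarrow> 'v \<Rightarrow> bool" where
  "rays_expensive d G v \<longleftrightarrow> (\<forall>\<epsilon>>0. \<exists>(m :: 'v \<Rightarrow> real) F. finite F \<and> F \<subseteq> verts G \<and> (\<forall>u. 0 \<le> m u) \<and> (\<forall>u. u \<notin> F \<longrightarrow> m u = 0) \<and>
     (\<Sum>u\<in>F. m u ^ d) \<le> \<epsilon> \<and> (\<forall>\<gamma>\<in>rays G v. 1 \<le> (\<Sum>u\<in>F \<inter> range \<gamma>. m u)))"

lemma rays_expensiveD:
  fixes \<epsilon> :: real
  assumes "rays_expensive d G v" "0 < \<epsilon>"
  obtains F m where "finite F" "F \<subseteq> verts G" "\<And>u. 0 \<le> m u" "\<And>u. u \<notin> F \<Longrightarrow> m u = 0"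
    "(\<Sum>u\<in>F. m u ^ d) \<le> \<epsilon>" "\<And>\<gamma>. \<gamma> \<in> rays G v \<Longrightarrow> 1 \<le> (\<Sum>u\<in>F \<inter> range \<gamma>. m u)"
proof -
  from assms obtain m F where "finite F \<and> F \<subseteq> verts G \<and> (\<forall>u. 0 \<le> m u) \<and> (\<forall>u. u \<notin> F \<longrightarrow> m u = 0) \<and>
     (\<Sum>u\<in>F. m u ^ d) \<le> \<epsilon> \<and> (\<forall>\<gamma>\<in>rays G v. 1 \<le> (\<Sum>u\<in>F \<inter> range \<gamma>. m u))"
    unfolding rays_expensive_def by (elim allE impE exE)
  then show ?thesis by (elim conjE, intro that[of F m]) (assumption | erule spec | erule (1) bspec | drule spec, erule (1) mp)+
qed

text \<open>The first \<open>R\<close> edges of a ray form a simple path inside the ball, so the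
  weight may be cut off outside the ball.\<close>

lemma rays_expensive_of_cheap_cut:
  assumes p: "is_rooted_graph (G, v)" and d: "0 < d" and cheap: "\<And>\<epsilon>. 0 < \<epsilon> \<Longrightarrow> \<exists>R. cheap_cut d \<epsilon> R (G, v)"
  shows "rays_expensive d G v"
  unfolding rays_expensive_def
proof (intro allI impI)
  fix \<epsilon> :: real assume "0 < \<epsilon>"
  then obtain R where "cheap_cut d \<epsilon> R (G, v)" using cheap by blast
  then obtain m where m: "\<And>u. 0 \<le> m u" "(\<Sum>u\<in>ball_verts G v R. m u ^ d) \<le> \<epsilon>"
    "\<And>\<gamma>. \<gamma> 0 = v \<Longrightarrow> inj_on \<gamma> {..R} \<Longrightarrow> (\<And>i. i < R \<Longrightarrow> {\<gamma> i, \<gamma> (Suc i)} \<in> edges G) \<Longrightarrow>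
        1 \<le> (\<Sum>i\<le>R. m (\<gamma> i))"
    unfolding cheap_cut_def fst_conv snd_conv by blast
  define F where "F = ball_verts G v R"
  have F: "finite F" "F \<subseteq> verts G" using finite_ball_verts[OF p] by (auto simp: F_def ball_verts_def)
  have "1 \<le> (\<Sum>u\<in>F \<inter> range \<gamma>. if u \<in> F then m u else 0)" if \<gamma>: "\<gamma> \<in> rays G v" for \<gamma>
  proof -
    have inj: "inj_on \<gamma> {..R}" using \<gamma> by (auto simp: rays_def intro: inj_on_subset)
    have "1 \<le> (\<Sum>i\<le>R. m (\<gamma> i))" using \<gamma> inj by (intro m(3)) (auto simp: rays_def)
    also have "\<dots> = (\<Sum>u\<in>\<gamma> ` {..R}. m u)" using inj by (simp add: sum.reindex)
    also have "\<dots> \<le> (\<Sum>u\<in>F \<inter> range \<gamma>. m u)"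
    proof (rule sum_mono2)
      show "\<gamma> ` {..R} \<subseteq> F \<inter> range \<gamma>"
        using path_in_ball[OF p, of \<gamma> R] \<gamma> by (auto simp: F_def rays_def)
    qed (use F m(1) in auto)
    also have "\<dots> = (\<Sum>u\<in>F \<inter> range \<gamma>. if u \<in> F then m u else 0)" by (intro sum.cong) auto
    finally show ?thesis .
  qed
  then show "\<exists>m F. finite F \<and> F \<subseteq> verts G \<and> (\<forall>u. 0 \<le> m u) \<and> (\<forall>u. u \<notin> F \<longrightarrow> m u = 0) \<and>
     (\<Sum>u\<in>F. m u ^ d) \<le> \<epsilon> \<and> (\<forall>\<gamma>\<in>rays G v. 1 \<le> (\<Sum>u\<in>F \<inter> range \<gamma>. m u))"
    using F m(1,2) by (intro exI[of _ "\<lambda>u. if u \<in> F then m u else 0"] exI[of _ F]) (simp add: F_def)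
qed

text \<open>
  A ray from a neighbour \<open>v\<close> of \<open>o\<close> either visits \<open>o\<close>, so contains a ray from \<open>o\<close>, or becomes a
  ray from \<open>o\<close> by prepending \<open>o\<close>, which costs at most \<open>1/2\<close>.
\<close>

lemma rays_expensive_step:
  assumes H: "rays_expensive d G o'" and d: "0 < d" and e: "{o', v} \<in> edges G"
  shows "rays_expensive d G v"
  unfolding rays_expensive_def
proof (intro allI impI)
  fix \<epsilon> :: real assume \<epsilon>: "0 < \<epsilon>"
  \<comment> \<open>The first bound absorbs the factor \<open>2 ^ d\<close> from doubling the
    weight; the second forces \<open>m o' \<le> 1 / 2\<close>, the cost allowed for prepending
    \<open>o'\<close>.\<close>
  define \<epsilon>' where "\<epsilon>' = min (\<epsilon> / 2 ^ d) ((1 / 2) ^ d)"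
  have \<epsilon>': "0 < \<epsilon>'" using \<epsilon> by (simp add: \<epsilon>'_def)
  obtain m F where F: "finite F" "F \<subseteq> verts G"
    and m: "\<And>u. 0 \<le> m u" "\<And>u. u \<notin> F \<Longrightarrow> m u = 0" "(\<Sum>u\<in>F. m u ^ d) \<le> \<epsilon>'"
      "\<And>\<gamma>. \<gamma> \<in> rays G o' \<Longrightarrow> 1 \<le> (\<Sum>u\<in>F \<inter> range \<gamma>. m u)" by (rule rays_expensiveD[OF H \<epsilon>'], rule that)
  have mo: "m o' \<le> 1 / 2"
  proof (cases "o' \<in> F")
    case True
    have "m o' ^ d \<le> (\<Sum>u\<in>F. m u ^ d)" using True F m(1) by (intro member_le_sum) auto
    also have "\<dots> \<le> (1 / 2) ^ d" using m(3) by (simp add: \<epsilon>'_def)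
    finally show ?thesis using power_mono_iff[of "m o'" "1 / 2" d] m(1) d by simp
  next
    case False
    then show ?thesis using m(2) by simp
  qed
  have "1 \<le> (\<Sum>u\<in>F \<inter> range \<gamma>. 2 * m u)" if \<gamma>: "\<gamma> \<in> rays G v" for \<gamma>
  proof (cases "o' \<in> range \<gamma>")
    case True
    then obtain j where j: "o' = \<gamma> j" by blast
    have "(\<lambda>i. \<gamma> (i + j)) \<in> rays G o'"
      unfolding rays_def
    proof (intro CollectI conjI allI)
      have "inj \<gamma>" using \<gamma> by (simp add: rays_def)
      show "inj (\<lambda>i. \<gamma> (i + j))"
      proof (rule injI)
        fix x y assume "\<gamma> (x + j) = \<gamma> (y + j)"
        from injD[OF \<open>inj \<gamma>\<close> this] show "x = y" by simp
      qed
      show "{\<gamma> (i + j), \<gamma> (Suc i + j)} \<in> edges G" for i using \<gamma> by (simp add: rays_def)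
    qed (simp add: j)
    from m(4)[OF this] have "1 \<le> (\<Sum>u\<in>F \<inter> range (\<lambda>i. \<gamma> (i + j)). m u)" .
    also have "\<dots> \<le> (\<Sum>u\<in>F \<inter> range \<gamma>. m u)" using F m(1) by (intro sum_mono2) auto
    finally show ?thesis by (simp add: sum_distrib_left[symmetric])
  next
    case False
    let ?\<gamma> = "case_nat o' \<gamma>"
    have "?\<gamma> \<in> rays G o'"
      unfolding rays_def
    proof (intro CollectI conjI allI)
      have g: "\<gamma> 0 = v" "inj \<gamma>" "\<And>i. {\<gamma> i, \<gamma> (Suc i)} \<in> edges G" using \<gamma> by (auto simp: rays_def)
      show "inj ?\<gamma>"
      proof (rule injI)
        fix i j assume "?\<gamma> i = ?\<gamma> j"
        then show "i = j" using False g(2) by (cases i; cases j) (auto dest: injD)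
      qed
      show "{?\<gamma> i, ?\<gamma> (Suc i)} \<in> edges G" for i using e g by (cases i) auto
    qed simp
    from m(4)[OF this] have "1 \<le> (\<Sum>u\<in>F \<inter> range ?\<gamma>. m u)" .
    also have "\<dots> \<le> (\<Sum>u\<in>insert o' (F \<inter> range \<gamma>). m u)"
      using F m(1) by (intro sum_mono2) (auto split: nat.splits)
    also have "\<dots> = m o' + (\<Sum>u\<in>F \<inter> range \<gamma>. m u)" using F False by simp
    finally show ?thesis using mo by (simp add: sum_distrib_left[symmetric])
  qed
  moreover have "(\<Sum>u\<in>F. (2 * m u) ^ d) \<le> \<epsilon>"
  proof -
    have "(\<Sum>u\<in>F. (2 * m u) ^ d) = 2 ^ d * (\<Sum>u\<in>F. m u ^ d)"
      by (simp add: power_mult_distrib sum_distrib_left)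
    also have "\<dots> \<le> 2 ^ d * (\<epsilon> / 2 ^ d)" using m(3) by (intro mult_left_mono) (simp_all add: \<epsilon>'_def)
    finally show ?thesis by simp
  qed
  ultimately show "\<exists>m F. finite F \<and> F \<subseteq> verts G \<and> (\<forall>u. 0 \<le> m u) \<and> (\<forall>u. u \<notin> F \<longrightarrow> m u = 0) \<and>
     (\<Sum>u\<in>F. m u ^ d) \<le> \<epsilon> \<and> (\<forall>\<gamma>\<in>rays G v. 1 \<le> (\<Sum>u\<in>F \<inter> range \<gamma>. m u))"
    using F m(1,2) by (intro exI[of _ "\<lambda>u. 2 * m u"] exI[of _ F]) simp
qed

text \<open>The weight is a competitor in the supremum: it is summable by finite support, has
  positive norm, and gives every ray length at least 1.\<close>

lemma VEL_ge_of_finite_support: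
  assumes d: "0 < d" and F: "finite F" "F \<subseteq> verts G" and m: "\<And>u. 0 \<le> m u" "\<And>u. u \<notin> F \<Longrightarrow> m u = 0"
    and pos: "0 < (\<Sum>u\<in>F. m u ^ d)"
    and long: "\<And>\<gamma>. \<gamma> \<in> rays G v \<Longrightarrow> 1 \<le> (\<Sum>u\<in>F \<inter> range \<gamma>. m u)"
  shows "ennreal (1 / (\<Sum>u\<in>F. m u ^ d)) \<le> VEL d G v"
proof -
  define S where "S = (\<Sum>u\<in>F. m u ^ d)"
  have sums: "((\<lambda>u. m u ^ d) has_sum S) (verts G)"
  proof -
    have "((\<lambda>u. m u ^ d) has_sum S) F" unfolding S_def by (rule has_sum_finite[OF F(1)])
    also have "?this \<longleftrightarrow> ?thesis" using F m(2) d by (intro has_sum_cong_neutral) auto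
    finally show ?thesis .
  qed
  then have norm: "vert_norm d G m = root d S" by (simp add: vert_norm_def infsumI)
  then have normd: "vert_norm d G m ^ d = S" using pos d by (simp add: S_def)
  have "m \<in> metrics d G"
    using m sums norm pos d by (auto simp: metrics_def S_def intro: has_sum_imp_summable)
  moreover have "ennreal (1 / S) \<le> (INF \<gamma>\<in>rays G v. path_length m \<gamma> ^ d / ennreal (vert_norm d G m ^ d))"
  proof (rule INF_greatest)
    fix \<gamma> assume \<gamma>: "\<gamma> \<in> rays G v"
    have "path_length m \<gamma> = (\<Sum>\<^sub>\<infinity>u\<in>F \<inter> range \<gamma>. ennreal (m u))"
      unfolding path_length_def using m(2) by (intro infsum_cong_neutral) auto
    also have "\<dots> = (\<Sum>u\<in>F \<inter> range \<gamma>. ennreal (m u))" using F by simp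
    also have "\<dots> = ennreal (\<Sum>u\<in>F \<inter> range \<gamma>. m u)" using m(1) by (intro sum_ennreal) auto
    finally have "1 \<le> path_length m \<gamma>" using long[OF \<gamma>] by (simp add: ennreal_ge_1)
    then have "1 \<le> path_length m \<gamma> ^ d" by (rule one_le_power)
    then have "1 / ennreal S \<le> path_length m \<gamma> ^ d / ennreal S" by (rule divide_right_mono_ennreal)
    moreover have "ennreal (1 / S) = 1 / ennreal S"
      using pos divide_ennreal[of 1 S] by (simp add: S_def)
    ultimately show "ennreal (1 / S) \<le> path_length m \<gamma> ^ d / ennreal (vert_norm d G m ^ d)"
      by (simp add: normd)
  qed
  ultimately show ?thesis unfolding VEL_def S_def[symmetric] by (rule SUP_upper2[where i = m])
qed

lemma VEL_eq_infinity:
  assumes H: "rays_expensive d G v" and d: "0 < d" and v: "v \<in> verts G"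
  shows "VEL d G v = \<infinity>"
proof -
  have big: "ennreal (1 / \<epsilon>) \<le> VEL d G v" if \<epsilon>: "0 < \<epsilon>" for \<epsilon>
  proof (cases "rays G v = {}")
    \<comment> \<open>Without rays the certificate may be the zero weight, which is not an
      admissible metric. A point mass of energy \<open>\<epsilon>\<close> at \<open>v\<close> serves
      instead.\<close>
    case True
    define m where "m u = (if u = v then root d \<epsilon> else 0)" for u
    have s: "(\<Sum>u\<in>{v}. m u ^ d) = \<epsilon>" using \<epsilon> d by (simp add: m_def)
    have "ennreal (1 / (\<Sum>u\<in>{v}. m u ^ d)) \<le> VEL d G v"
      using \<epsilon> d v True s by (intro VEL_ge_of_finite_support) (auto simp: m_def)
    then show ?thesis unfolding s .
  next
    case False
    then obtain \<gamma>0 where \<gamma>0: "\<gamma>0 \<in> rays G v" by blast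
    obtain m F where F: "finite F" "F \<subseteq> verts G"
      and m: "\<And>u. 0 \<le> m u" "\<And>u. u \<notin> F \<Longrightarrow> m u = 0" "(\<Sum>u\<in>F. m u ^ d) \<le> \<epsilon>"
      "\<And>\<gamma>. \<gamma> \<in> rays G v \<Longrightarrow> 1 \<le> (\<Sum>u\<in>F \<inter> range \<gamma>. m u)" by (rule rays_expensiveD[OF H \<epsilon>], rule that)
    have "\<exists>u\<in>F. m u \<noteq> 0"
    proof (rule ccontr)
      assume "\<not> ?thesis"
      then have "(\<Sum>u\<in>F \<inter> range \<gamma>0. m u) = 0" by (intro sum.neutral) auto
      then show False using m(4)[OF \<gamma>0] by simp
    qed
    then obtain u where u: "u \<in> F" "0 < m u" using m(1) by (metis less_eq_real_def)
    then have pos: "0 < (\<Sum>u\<in>F. m u ^ d)"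
      using F m(1) by (intro sum_pos2[of F u]) auto
    have "ennreal (1 / \<epsilon>) \<le> ennreal (1 / (\<Sum>u\<in>F. m u ^ d))"
      using m(3) pos by (intro ennreal_leI divide_left_mono) auto
    also have "\<dots> \<le> VEL d G v" by (rule VEL_ge_of_finite_support[OF d F m(1,2) pos m(4)])
    finally show ?thesis .
  qed
  show ?thesis
  proof (rule ccontr)
    assume "VEL d G v \<noteq> \<infinity>"
    then obtain x where x: "0 \<le> x" "VEL d G v = ennreal x" by (cases "VEL d G v") auto
    have "ennreal (x + 1) \<le> ennreal x" using big[of "1 / (x + 1)"] x by simp
    then show False using x by simp
  qed
qed

text \<open>Cheapness is known only at the root. The certificate is carried to every other vertex
  along a walk, one edge at a time.\<close>

lemma parabolic_of_cheap_cuts: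
  assumes p: "is_rooted_graph (G, v)" and d: "0 < d" and cheap: "\<And>\<epsilon>. 0 < \<epsilon> \<Longrightarrow> \<exists>R. cheap_cut d \<epsilon> R (G, v)"
  shows "parabolic_graph d G"
  unfolding parabolic_graph_def
proof
  fix w assume w: "w \<in> verts G"
  then have "(v, w) \<in> (adj_rel G)\<^sup>*" using p by (auto simp: is_rooted_graph_def connected_graph_def)
  then have "rays_expensive d G w"
  proof (induction rule: rtrancl_induct)
    case base
    show ?case by (rule rays_expensive_of_cheap_cut[OF p d cheap])
  next
    case (step y z)
    then have "{y, z} \<in> edges G" by (simp add: adj_rel_def)
    with step.IH d show ?case by (rule rays_expensive_step)
  qed
  then show "VEL d G w = \<infinity>" using d w by (rule VEL_eq_infinity)
qed

section \<open>The limit\<close>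

lemma rooted_graph_cases:
  obtains p where "is_rooted_graph p" "rooted_rel p p" "x = abs_rooted_graph p"
proof -
  have "rooted_rel (rep_rooted_graph x) (rep_rooted_graph x)" "abs_rooted_graph (rep_rooted_graph x) = x"
    using Quotient_rep_reflp[OF Quotient_rooted_graph] Quotient_abs_rep[OF Quotient_rooted_graph] by auto
  then show ?thesis by (intro that[of "rep_rooted_graph x"]) (simp_all add: rooted_rel_def)
qed

lift_definition cheap_cut_class :: "nat \<Rightarrow> real \<Rightarrow> nat \<Rightarrow> rooted_graph \<Rightarrow> bool" is cheap_cut
  by (rule cheap_cut_cong) (auto simp: rooted_rel_def intro: rooted_iso_imp_iso_depths)

text \<open>Were all depths below \<open>R\<close>, their supremum would be at most \<open>R\<close>
  and the distance at least \<open>inverse (1 + real R)\<close>. So some depth reaches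
  \<open>R\<close>, and depths are downward closed.\<close>

lemma local_dist_less_imp_iso_depth:
  assumes p: "is_rooted_graph p" and q: "is_rooted_graph q"
    and less: "local_dist p q < inverse (1 + real R)"
  shows "R \<in> iso_depths p q"
proof -
  have "\<exists>j\<in>iso_depths p q. R \<le> j"
  proof (rule ccontr)
    assume "\<not> ?thesis"
    then have le: "j \<le> R" if "j \<in> iso_depths p q" for j using that by auto
    then have "bdd_above (iso_depths p q)" by (rule bdd_aboveI)
    moreover have "Sup (iso_depths p q) \<le> R"
      using zero_in_iso_depths[OF p q] le by (intro cSup_least) auto
    ultimately show False
      using less by (simp add: local_dist_def le_imp_inverse_le not_less[symmetric])
  qed
  then show ?thesis using iso_depths_down[OF p q] by blast
qed

lemma cheap_cut_class_cong:
  assumes "dist x y < inverse (1 + real R)"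
  shows "cheap_cut_class d \<epsilon> R x \<longleftrightarrow> cheap_cut_class d \<epsilon> R y"
  using assms
proof (transfer fixing: R d \<epsilon>)
  fix p q :: "nat ugraph \<times> nat"
  assume "rooted_rel p p" "rooted_rel q q" "local_dist p q < inverse (1 + real R)"
  then show "cheap_cut d \<epsilon> R p \<longleftrightarrow> cheap_cut d \<epsilon> R q"
    by (intro cheap_cut_cong local_dist_less_imp_iso_depth) (auto simp: rooted_rel_def)
qed

text \<open>Membership is constant on balls of radius \<open>inverse (1 + real R)\<close>.\<close>

lemma open_cheap_cut_class: "open {x. cheap_cut_class d \<epsilon> R x}" "open {x. \<not> cheap_cut_class d \<epsilon> R x}"
proof -
  have "0 < inverse (1 + real R)" by simp
  then show "open {x. cheap_cut_class d \<epsilon> R x}" "open {x. \<not> cheap_cut_class d \<epsilon> R x}"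
    unfolding open_dist using cheap_cut_class_cong by blast+
qed

section \<open>Isolation of finite rooted graphs\<close>

text \<open>Let \<open>N\<close> be the greatest distance from the root of \<open>p\<close>. An
  isomorphism at depth \<open>Suc N\<close> shows that the balls of \<open>q\<close> stop growing
  from \<open>N\<close> to \<open>Suc N\<close>, so by connectedness they exhaust \<open>q\<close>.
  The additional level is what detects this.\<close>

lemma finite_rooted_iso_of_deep_ball:
  assumes p: "is_rooted_graph p" and fin: "finite (verts (fst p))"
  shows "\<exists>k. \<forall>q :: 'u ugraph \<times> 'u. is_rooted_graph q \<longrightarrow> k \<in> iso_depths p q \<longrightarrow> rooted_iso p q"
proof -
  define N where "N = Max (graph_dist (fst p) (snd p) ` verts (fst p))"
  have "graph_dist (fst p) (snd p) v \<le> N" if "v \<in> verts (fst p)" for v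
    using fin that by (simp add: N_def)
  then have ball: "ball_verts (fst p) (snd p) k = verts (fst p)" if "N \<le> k" for k
    using order_trans[OF _ that] unfolding ball_verts_def by blast
  have "rooted_iso p q" if q: "is_rooted_graph q" and k: "Suc N \<in> iso_depths p q" for q :: "'u ugraph \<times> 'u"
  proof -
    let ?C = "ball_verts (fst q) (snd q)"
    from k obtain f where f: "ball_iso_map f p q (Suc N)" by (auto simp: iso_depths_iff)
    have "?C N = ?C (Suc N)"
      using ball_iso_map_image[OF p q f, of N] ball_iso_map_image[OF p q f, of "Suc N"] ball[of N] ball[of "Suc N"]
      by simp
    then have nbr: "v \<in> ?C N" if "u \<in> ?C N" "{u, v} \<in> edges (fst q)" for u v
      using ball_verts_Suc[OF q, of N] that by blast
    have "v \<in> ?C N" if v: "v \<in> verts (fst q)" for v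
    proof -
      have "(snd q, v) \<in> (adj_rel (fst q))\<^sup>*"
        using q v by (auto simp: is_rooted_graph_def connected_graph_def)
      then show ?thesis
      proof (induction rule: rtrancl_induct)
        case (step y z)
        then show ?case using nbr[of y z] by (simp add: adj_rel_def)
      qed (rule root_in_ball[OF q])
    qed
    then have C: "?C (Suc N) = verts (fst q)" using \<open>?C N = ?C (Suc N)\<close> by (auto simp: ball_verts_def)
    have "graph_iso_map f (fst p) (fst q)"
      using f unfolding ball_iso_map_iff C ball[of "Suc N", simplified] by (simp add: graph_iso_map_def)
    moreover have "f (snd p) = snd q" using f by (simp add: ball_iso_map_iff)
    ultimately show ?thesis unfolding rooted_iso_def by blast
  qed
  then show ?thesis by blast
qed

lemma finite_rooted_graph_isolated:
  assumes "finite_rooted_graph x"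
  shows "\<exists>e>0. \<forall>y. dist x y < e \<longrightarrow> y = x"
proof -
  obtain p where p: "is_rooted_graph p" "rooted_rel p p" "x = abs_rooted_graph p" by (rule rooted_graph_cases)
  have "finite (verts (fst p))" using assms p by (simp add: finite_rooted_graph.abs_eq)
  then obtain k where k: "\<And>q :: nat ugraph \<times> nat. is_rooted_graph q \<Longrightarrow> k \<in> iso_depths p q \<Longrightarrow> rooted_iso p q"
    using finite_rooted_iso_of_deep_ball[OF p(1)] by blast
  have "y = x" if y: "dist x y < inverse (1 + real k)" for y
  proof -
    obtain q where q: "is_rooted_graph q" "rooted_rel q q" "y = abs_rooted_graph q" by (rule rooted_graph_cases)
    have "local_dist p q < inverse (1 + real k)" using y p q by (simp add: dist_rooted_graph.abs_eq)
    then have "k \<in> iso_depths p q" by (rule local_dist_less_imp_iso_depth[OF p(1) q(1)])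
    then have "rooted_rel p q" using k p q by (simp add: rooted_rel_def)
    then have "abs_rooted_graph p = abs_rooted_graph q"
      using Quotient_rel_abs[OF Quotient_rooted_graph] by blast
    then show ?thesis using p q by simp
  qed
  then show ?thesis by (intro exI[of _ "inverse (1 + real k)"]) auto
qed

text \<open>Finite rooted graphs are isolated points. This later makes the events of having a given
  finite unrooted graph measurable.\<close>

lemma open_of_finite_rooted_graphs:
  assumes "\<And>x. x \<in> S \<Longrightarrow> finite_rooted_graph x"
  shows "open S"
  unfolding open_dist
proof
  fix x assume x: "x \<in> S"
  obtain e where "e > 0" "\<And>y. dist x y < e \<Longrightarrow> y = x" using finite_rooted_graph_isolated[OF assms[OF x]] by blast
  then show "\<exists>e>0. \<forall>y. dist y x < e \<longrightarrow> y \<in> S" using x by (metis dist_commute)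
qed

lemma graph_iso_map_edge_vertex:
  assumes "graph_iso_map f G H" "{u, v} \<in> edges G" "u \<in> verts G" "v \<in> verts G"
  shows "{f u, f v} \<in> edges H"
  using assms by (simp add: graph_iso_map_def)

lemma connected_graph_iso:
  assumes iso: "graph_iso G H" and G: "connected_graph G" "simple_graph G"
  shows "connected_graph H"
  unfolding connected_graph_def
proof (intro ballI)
  obtain f where f: "graph_iso_map f G H" using iso unfolding graph_iso_def by blast
  fix u v assume "u \<in> verts H" "v \<in> verts H"
  then have "u \<in> f ` verts G" "v \<in> f ` verts G" using f by (auto simp: graph_iso_map_def bij_betw_def)
  then obtain a b where ab: "a \<in> verts G" "b \<in> verts G" "u = f a" "v = f b" by blast
  have "(a, b) \<in> (adj_rel G)\<^sup>*" using G ab by (simp add: connected_graph_def)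
  then have "(f a, f b) \<in> (adj_rel H)\<^sup>*"
  proof (induction rule: rtrancl_induct)
    case (step y z)
    then have "{y, z} \<in> edges G" by (simp add: adj_rel_def)
    then have "(f y, f z) \<in> adj_rel H"
      using graph_iso_map_edge_vertex[OF f] simple_graph_edgeD[OF G(2)] by (simp add: adj_rel_def)
    with step.IH show ?case by (rule rtrancl_into_rtrancl)
  qed simp
  then show "(u, v) \<in> (adj_rel H)\<^sup>*" using ab by simp
qed

section \<open>Total probability over finite unrooted graphs\<close>

text \<open>One graph is selected for each unrooted isomorphism class, so that distinct models give
  disjoint events. Simplicity is demanded separately because \<open>has_graph\<close> does not see
  edges leaving the vertex set.\<close>

definition model :: "rooted_graph \<Rightarrow> nat ugraph" where
  "model x = (SOME H. simple_graph H \<and> has_graph x H)"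

lemma model: "simple_graph (model x)" "has_graph x (model x)"
proof -
  obtain p where p: "is_rooted_graph p" "rooted_rel p p" "x = abs_rooted_graph p" by (rule rooted_graph_cases)
  then have "simple_graph (fst p) \<and> has_graph x (fst p)"
    by (simp add: has_graph.abs_eq is_rooted_graph_def graph_iso_refl)
  then have "\<exists>H. simple_graph H \<and> has_graph x H" by blast
  from someI_ex[OF this] show "simple_graph (model x)" "has_graph x (model x)" unfolding model_def by auto
qed

text \<open>The two rooted graphs satisfy the same predicate \<open>has_graph\<close>, on which
  alone the choice in \<open>model\<close> depends.\<close>

lemma has_graph_unique:
  assumes "has_graph x H" "has_graph y H"
  shows "model x = model y"
proof -
  obtain p q where p: "rooted_rel p p" "x = abs_rooted_graph p" and q: "rooted_rel q q" "y = abs_rooted_graph q"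
    using rooted_graph_cases by metis
  have "graph_iso (fst p) (fst q)"
    using assms p q by (auto simp: has_graph.abs_eq intro: graph_iso_trans graph_iso_sym)
  then have "has_graph x K = has_graph y K" for K
    using p q graph_iso_cong[of "fst p" "fst q" K] by (simp add: has_graph.abs_eq)
  then have "has_graph x = has_graph y" by (rule ext)
  then show ?thesis by (simp add: model_def)
qed

lemma has_graph_transfer:
  assumes "has_graph x H" "simple_graph H"
  shows "connected_graph H" "verts H \<noteq> {}" "finite_rooted_graph x \<longleftrightarrow> finite (verts H)"
    "uniform_rooted_graph T M x \<longleftrightarrow> uniform_graph T M H"
proof -
  obtain p where p: "is_rooted_graph p" "rooted_rel p p" "x = abs_rooted_graph p" by (rule rooted_graph_cases)
  then have iso: "graph_iso (fst p) H" using assms by (simp add: has_graph.abs_eq)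
  show "connected_graph H" using connected_graph_iso[OF iso] p by (simp add: is_rooted_graph_def)
  show "verts H \<noteq> {}"
    using iso p by (auto simp: graph_iso_def graph_iso_map_def is_rooted_graph_def bij_betw_def)
  show "finite_rooted_graph x \<longleftrightarrow> finite (verts H)"
    using graph_iso_finite[OF iso] p by (simp add: finite_rooted_graph.abs_eq)
  show "uniform_rooted_graph T M x \<longleftrightarrow> uniform_graph T M H"
    using uniform_graph_iso[OF iso] p by (simp add: uniform_rooted_graph.abs_eq)
qed

lemma countable_finite_simple_graphs: "countable {H :: nat ugraph. simple_graph H \<and> finite (verts H)}"
proof -
  have "{H :: nat ugraph. simple_graph H \<and> finite (verts H)}
     \<subseteq> (\<lambda>(V, E). \<lparr>verts = V, edges = E\<rparr>) ` ({V. finite V} \<times> {E. finite E \<and> E \<subseteq> {e. finite e}})"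
  proof
    fix H :: "nat ugraph" assume H: "H \<in> {H. simple_graph H \<and> finite (verts H)}"
    then have "edges H \<subseteq> Pow (verts H)" by (auto simp: simple_graph_def)
    then have "finite (edges H)" "edges H \<subseteq> {e. finite e}"
      using H by (auto intro: finite_subset)
    then show "H \<in> (\<lambda>(V, E). \<lparr>verts = V, edges = E\<rparr>) ` ({V. finite V} \<times> {E. finite E \<and> E \<subseteq> {e. finite e}})"
      using H by (intro image_eqI[of _ _ "(verts H, edges H)"]) auto
  qed
  moreover have "countable ({V :: nat set. finite V} \<times> {E. finite E \<and> E \<subseteq> {e :: nat set. finite e}})"
  proof (intro countable_SIGMA)
    show "countable {V :: nat set. finite V}"
      using countable_Collect_finite by simp
    then show "countable {E. finite E \<and> E \<subseteq> {e :: nat set. finite e}}"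
      by (rule countable_Collect_finite_subset)
  qed
  ultimately show ?thesis by (meson countable_image countable_subset)
qed

text \<open>Total probability over the countably many finite models: given the unrooted graph
  \<open>H\<close>, the probability of \<open>B\<close> is the fraction of vertices of
  \<open>H\<close> that root it in \<open>B\<close>, which is at most
  \<open>\<delta>\<close>.\<close>

lemma unbiased_prob_le:
  assumes prob: "prob_space \<Omega>" and unb: "unbiased \<Omega> X" and B: "B \<in> sets borel" and \<delta>: "0 \<le> \<delta>"
    and good: "AE \<omega> in \<Omega>. good (X \<omega>)"
    and bound: "\<And>x H. good x \<Longrightarrow> has_graph x H \<Longrightarrow> simple_graph H \<Longrightarrow> finite (verts H) \<Longrightarrow>
      real (card {v\<in>verts H. rooted_class H v \<in> B}) \<le> \<delta> * real (card (verts H))"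
  shows "measure \<Omega> {\<omega>\<in>space \<Omega>. X \<omega> \<in> B} \<le> \<delta>"
proof -
  interpret prob_space \<Omega> by (rule prob)
  have X: "X \<in> borel_measurable \<Omega>" and fin: "AE \<omega> in \<Omega>. finite_rooted_graph (X \<omega>)"
    and cond: "\<And>H A. simple_graph H \<Longrightarrow> connected_graph H \<Longrightarrow> finite (verts H) \<Longrightarrow> verts H \<noteq> {} \<Longrightarrow>
      \<P>(\<omega> in \<Omega>. has_graph (X \<omega>) H) > 0 \<Longrightarrow> A \<in> sets borel \<Longrightarrow>
      \<P>(\<omega> in \<Omega>. X \<omega> \<in> A \<bar> has_graph (X \<omega>) H) =
           measure_pmf.prob (pmf_of_set (verts H)) {v. rooted_class H v \<in> A}"
    using unb unfolding unbiased_def by blast+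
  define I where "I = model ` {x. finite_rooted_graph x}"
  have I: "simple_graph H" "finite (verts H)" "connected_graph H" "verts H \<noteq> {}" if "H \<in> I" for H
    using that model has_graph_transfer[OF model(2,1)] by (auto simp: I_def)
  have "countable I"
    by (rule countable_subset[OF _ countable_finite_simple_graphs]) (use I in auto)
  define A where "A H = {\<omega>\<in>space \<Omega>. has_graph (X \<omega>) H}" for H
  have meas: "{\<omega>\<in>space \<Omega>. X \<omega> \<in> S} \<in> sets \<Omega>" if "S \<in> sets borel" for S
    using measurable_sets[OF X that] by (simp add: vimage_def Int_def conj_commute)
  have A: "A H \<in> sets \<Omega>" if "H \<in> I" for H
  proof -
    have "open {x. has_graph x H}"
      using has_graph_transfer(3) I that by (intro open_of_finite_rooted_graphs) blast
    then show ?thesis using meas[of "{x. has_graph x H}"] by (simp add: A_def)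
  qed
  have AB: "A H \<inter> {\<omega>\<in>space \<Omega>. X \<omega> \<in> B} \<in> sets \<Omega>" if "H \<in> I" for H
    using A[OF that] meas[OF B] by blast
  have disj: "disjoint_family_on A I"
    unfolding disjoint_family_on_def
  proof (intro ballI impI equals0I)
    fix H K \<omega> assume HK: "H \<in> I" "K \<in> I" "H \<noteq> K" and w: "\<omega> \<in> A H \<inter> A K"
    from HK obtain x y where xy: "H = model x" "K = model y" by (auto simp: I_def)
    then have "model (X \<omega>) = model x" "model (X \<omega>) = model y"
      using w model(2) by (auto simp: A_def intro: has_graph_unique)
    then show False using HK xy by simp
  qed
  have le: "emeasure \<Omega> (A H \<inter> {\<omega>\<in>space \<Omega>. X \<omega> \<in> B}) \<le> ennreal \<delta> * emeasure \<Omega> (A H)" if H: "H \<in> I" for H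
  proof -
    have "prob (A H \<inter> {\<omega>\<in>space \<Omega>. X \<omega> \<in> B}) \<le> \<delta> * prob (A H)"
    proof (cases "prob (A H) = 0")
      case True
      then show ?thesis using finite_measure_mono[of "A H \<inter> {\<omega>\<in>space \<Omega>. X \<omega> \<in> B}" "A H"] A[OF H] by simp
    next
      case False
      then have pos: "0 < prob (A H)" by (simp add: zero_less_measure_iff)
      \<comment> \<open>An event of positive probability meets the almost sure event
        \<open>good\<close>, so some sample makes \<open>bound\<close> applicable to
        \<open>H\<close>.\<close>
      have "\<not> (AE \<omega> in \<Omega>. \<not> has_graph (X \<omega>) H)"
      proof
        assume "AE \<omega> in \<Omega>. \<not> has_graph (X \<omega>) H"
        then have "prob (A H) = prob {}"
          using A[OF H] by (intro finite_measure_eq_AE) (auto simp: A_def elim: AE_mp)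
        then show False using pos by simp
      qed
      then have "\<exists>\<omega>. good (X \<omega>) \<and> has_graph (X \<omega>) H"
        using good by (metis (mono_tags, lifting) AE_mp AE_I2)
      then have card: "real (card {v\<in>verts H. rooted_class H v \<in> B}) \<le> \<delta> * real (card (verts H))"
        using bound I[OF H] by blast
      have "prob (A H \<inter> {\<omega>\<in>space \<Omega>. X \<omega> \<in> B}) / prob (A H) = \<P>(\<omega> in \<Omega>. X \<omega> \<in> B \<bar> has_graph (X \<omega>) H)"
        by (auto simp: cond_prob_def A_def intro!: arg_cong2[of _ _ _ _ "(/)"] arg_cong[of _ _ prob])
      also have "\<dots> = measure_pmf.prob (pmf_of_set (verts H)) {v. rooted_class H v \<in> B}"
        using pos I[OF H] B by (intro cond) (auto simp: A_def)
      also have "\<dots> = real (card {v\<in>verts H. rooted_class H v \<in> B}) / real (card (verts H))"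
        using I[OF H] by (simp add: measure_pmf_of_set Int_def)
      also have "\<dots> \<le> \<delta>"
        using card I[OF H] by (simp add: pos_divide_le_eq card_gt_0_iff)
      finally show ?thesis using pos by (simp add: pos_divide_le_eq)
    qed
    then show ?thesis using \<delta> by (simp add: emeasure_eq_measure ennreal_mult[symmetric] ennreal_leI)
  qed
  \<comment> \<open>Almost surely the graph is finite, and then its own model belongs to
    \<open>I\<close>.\<close>
  have "AE \<omega> in \<Omega>. \<omega> \<in> {\<omega>\<in>space \<Omega>. X \<omega> \<in> B} \<longrightarrow> \<omega> \<in> (\<Union>H\<in>I. A H \<inter> {\<omega>\<in>space \<Omega>. X \<omega> \<in> B})"
    using fin by (rule AE_mp) (auto simp: I_def A_def model intro!: AE_I2)
  then have "emeasure \<Omega> {\<omega>\<in>space \<Omega>. X \<omega> \<in> B} \<le> emeasure \<Omega> (\<Union>H\<in>I. A H \<inter> {\<omega>\<in>space \<Omega>. X \<omega> \<in> B})"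
    using \<open>countable I\<close> AB by (intro emeasure_mono_AE sets.countable_UN') auto
  also have "\<dots> = (\<integral>\<^sup>+H. emeasure \<Omega> (A H \<inter> {\<omega>\<in>space \<Omega>. X \<omega> \<in> B}) \<partial>count_space I)"
    using \<open>countable I\<close> AB disj by (intro emeasure_UN_countable) (auto simp: disjoint_family_on_def)
  also have "\<dots> \<le> (\<integral>\<^sup>+H. ennreal \<delta> * emeasure \<Omega> (A H) \<partial>count_space I)"
    using le by (intro nn_integral_mono) simp
  also have "\<dots> = ennreal \<delta> * (\<integral>\<^sup>+H. emeasure \<Omega> (A H) \<partial>count_space I)"
    by (rule nn_integral_cmult) simp
  also have "(\<integral>\<^sup>+H. emeasure \<Omega> (A H) \<partial>count_space I) = emeasure \<Omega> (\<Union>H\<in>I. A H)"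
    using \<open>countable I\<close> A disj by (intro emeasure_UN_countable[symmetric]) auto
  also have "ennreal \<delta> * \<dots> \<le> ennreal \<delta> * 1"
    by (intro mult_left_mono emeasure_le_1) simp
  finally have "ennreal (prob {\<omega>\<in>space \<Omega>. X \<omega> \<in> B}) \<le> ennreal \<delta>" by (simp add: emeasure_eq_measure)
  then show ?thesis using \<delta> by simp
qed

section \<open>Passage to the weak limit\<close>

lemma integral_indicator_distr:
  assumes "Z \<in> borel_measurable L" "S \<in> sets borel"
  shows "(\<integral>x. indicator S x \<partial>distr L borel Z :: real) = measure L {\<omega>\<in>space L. Z \<omega> \<in> S}"
proof -
  have "(\<integral>x. indicator S x \<partial>distr L borel Z :: real) = measure (distr L borel Z) S" by simp
  also have "\<dots> = measure L (Z -` S \<inter> space L)" using assms by (intro measure_distr) auto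
  finally show ?thesis by (simp add: vimage_def Int_def conj_commute)
qed

text \<open>The indicator of a clopen set is a bounded continuous function, hence an admissible test
  function.\<close>

lemma weakly_converges_clopen:
  fixes X :: "nat \<Rightarrow> 'w \<Rightarrow> 'a::topological_space" and Y :: "'z \<Rightarrow> 'a"
  assumes conv: "weakly_converges (\<lambda>n. distr \<Omega> borel (X n)) (distr \<Omega>' borel Y)"
    and X: "\<And>n. X n \<in> borel_measurable \<Omega>" and Y: "Y \<in> borel_measurable \<Omega>'"
    and S: "open S" "open (- S)"
  shows "(\<lambda>n. measure \<Omega> {\<omega>\<in>space \<Omega>. X n \<omega> \<in> S}) \<longlonglongrightarrow> measure \<Omega>' {\<omega>\<in>space \<Omega>'. Y \<omega> \<in> S}"
proof -
  have cont: "continuous_on UNIV (indicator S :: 'a \<Rightarrow> real)"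
  proof -
    have "continuous_on (S \<union> - S) (\<lambda>x. if x \<in> S then 1 else 0 :: real)"
      using S by (intro continuous_on_If) (auto simp: closed_def)
    also have "(\<lambda>x. if x \<in> S then 1 else 0 :: real) = indicator S" by (auto simp: indicator_def)
    finally show ?thesis by (simp only: Compl_partition)
  qed
  have "(indicator S :: 'a \<Rightarrow> real) \<in> bcontfun"
  proof (rule bcontfun_normI[OF cont])
    show "norm (indicator S x :: real) \<le> 1" for x by (simp add: indicator_def)
  qed
  then have "(\<lambda>n. \<integral>x. indicator S x \<partial>distr \<Omega> borel (X n)) \<longlonglongrightarrow> (\<integral>x. indicator S x \<partial>distr \<Omega>' borel Y :: real)"
    using conv unfolding weakly_converges_def by blast
  then show ?thesis using S X Y by (simp only: integral_indicator_distr borel_open)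
qed

theorem theorem2p9:
  fixes M :: real and d :: nat
    and \<Omega> :: "'w measure" and X :: "nat \<Rightarrow> 'w \<Rightarrow> rooted_graph"
    and \<Omega>' :: "'z measure" and Y :: "'z \<Rightarrow> rooted_graph"
  assumes "M \<ge> 0" and "d \<ge> 2" and "CARD('d::finite) = d"
    and "prob_space \<Omega>" and "prob_space \<Omega>'"
    and "\<And>n. unbiased \<Omega> (X n)"
    and "AE \<omega> in \<Omega>. \<forall>n. uniform_rooted_graph TYPE(real ^ 'd) M (X n \<omega>)"
    and "Y \<in> borel_measurable \<Omega>'"
    and "weakly_converges (\<lambda>n. distr \<Omega> borel (X n)) (distr \<Omega>' borel Y)"
  shows "AE \<omega> in \<Omega>'. parabolic_rooted_graph d (Y \<omega>)"
proof -
  interpret \<Omega>: prob_space \<Omega> by fact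
  interpret \<Omega>': prob_space \<Omega>' by fact
  have X: "X n \<in> borel_measurable \<Omega>" for n using assms(6)[of n] by (simp add: unbiased_def)
  note Y = assms(8)
  have cheap: "AE \<omega> in \<Omega>'. \<exists>R. cheap_cut_class d \<epsilon> R (Y \<omega>)" if \<epsilon>: "0 < \<epsilon>" for \<epsilon>
  proof -
    define Z where "Z = {\<omega>\<in>space \<Omega>'. \<forall>R. \<not> cheap_cut_class d \<epsilon> R (Y \<omega>)}"
    have Z_eq: "Z = (\<Inter>R. Y -` {x. \<not> cheap_cut_class d \<epsilon> R x} \<inter> space \<Omega>')" by (auto simp: Z_def)
    have Z: "Z \<in> sets \<Omega>'"
      unfolding Z_eq using measurable_sets[OF Y borel_open[OF open_cheap_cut_class(2)]] by (intro sets.countable_INT) auto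
    have "\<Omega>'.prob Z \<le> \<delta>" if \<delta>: "0 < \<delta>" for \<delta>
    proof -
      obtain R where R: "\<And>H :: nat ugraph. simple_graph H \<Longrightarrow> finite (verts H) \<Longrightarrow>
          uniform_graph TYPE(real ^ 'd) M H \<Longrightarrow>
          real (card {v\<in>verts H. \<not> cheap_cut d \<epsilon> R (H, v)}) \<le> \<delta> * real (card (verts H))"
        using card_not_cheap_cut_le[where 'd = 'd and 'v = nat, OF assms(1) _ \<epsilon> \<delta>] assms(2,3) by auto
      let ?B = "{x. \<not> cheap_cut_class d \<epsilon> R x}"
      have "\<Omega>.prob {\<omega>\<in>space \<Omega>. X n \<omega> \<in> ?B} \<le> \<delta>" for n
      proof (rule unbiased_prob_le[OF assms(4,6), where good = "uniform_rooted_graph TYPE(real ^ 'd) M"])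
        show "?B \<in> sets borel" using open_cheap_cut_class(2) by (rule borel_open)
        show "AE \<omega> in \<Omega>. uniform_rooted_graph TYPE(real ^ 'd) M (X n \<omega>)" using assms(7) by auto
        fix x H assume H: "uniform_rooted_graph TYPE(real ^ 'd) M x" "has_graph x H" "simple_graph H" "finite (verts H)"
        have "cheap_cut_class d \<epsilon> R (rooted_class H v) \<longleftrightarrow> cheap_cut d \<epsilon> R (H, v)" if "v \<in> verts H" for v
        proof -
          have "locally_finite_graph H"
            using simple_graph_edgeD(2)[OF H(3)] H(4)
            by (auto simp: locally_finite_graph_def intro: finite_subset[of _ "verts H"])
          then have "rooted_rel (H, v) (H, v)"
            using that H has_graph_transfer(1)[OF H(2,3)]
            by (simp add: rooted_rel_def is_rooted_graph_def rooted_iso_refl)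
          then show ?thesis by (simp add: rooted_class_def cheap_cut_class.abs_eq)
        qed
        then have "{v\<in>verts H. rooted_class H v \<in> ?B} = {v\<in>verts H. \<not> cheap_cut d \<epsilon> R (H, v)}" by auto
        then show "real (card {v\<in>verts H. rooted_class H v \<in> ?B}) \<le> \<delta> * real (card (verts H))"
          using R[OF H(3,4)] H(1) has_graph_transfer(4)[OF H(2,3), of "TYPE(real ^ 'd)" M] by simp
      qed (use \<delta> in simp)
      moreover have "(\<lambda>n. \<Omega>.prob {\<omega>\<in>space \<Omega>. X n \<omega> \<in> ?B}) \<longlonglongrightarrow> \<Omega>'.prob {\<omega>\<in>space \<Omega>'. Y \<omega> \<in> ?B}"
        using open_cheap_cut_class[of d \<epsilon> R]
        by (intro weakly_converges_clopen[OF assms(9) X Y]) (simp_all add: Compl_eq)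
      ultimately have "\<Omega>'.prob {\<omega>\<in>space \<Omega>'. Y \<omega> \<in> ?B} \<le> \<delta>" by (intro LIMSEQ_le_const2) auto
      \<comment> \<open>The depth \<open>R\<close> depends on \<open>\<delta>\<close>, but
        \<open>Z\<close> excludes cheapness at every depth, so it lies in this event whatever
        \<open>R\<close> is.\<close>
      moreover have "\<Omega>'.prob Z \<le> \<Omega>'.prob {\<omega>\<in>space \<Omega>'. Y \<omega> \<in> ?B}"
        using measurable_sets[OF Y borel_open[OF open_cheap_cut_class(2)[of d \<epsilon> R]]]
        by (intro \<Omega>'.finite_measure_mono) (auto simp: Z_def vimage_def Int_def conj_commute)
      ultimately show ?thesis by linarith
    qed
    then have "\<Omega>'.prob Z \<le> 0" by (rule field_le_epsilon[of _ 0, simplified])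
    then have "\<Omega>'.prob Z = 0" using measure_nonneg[of \<Omega>' Z] by linarith
    then have "Z \<in> null_sets \<Omega>'" using Z by (simp add: null_sets_def \<Omega>'.emeasure_eq_measure)
    then show ?thesis by (rule AE_I') (auto simp: Z_def)
  qed
  \<comment> \<open>Restricting \<open>\<epsilon>\<close> to a sequence tending to 0 leaves only
    countably many null sets to discard.\<close>
  have "AE \<omega> in \<Omega>'. \<forall>k. \<exists>R. cheap_cut_class d (1 / real (Suc k)) R (Y \<omega>)"
    unfolding AE_all_countable by (intro allI cheap) simp
  then show ?thesis
  proof (rule AE_mp, intro AE_I2 impI)
    fix \<omega> assume *: "\<forall>k. \<exists>R. cheap_cut_class d (1 / real (Suc k)) R (Y \<omega>)"
    obtain p where p: "is_rooted_graph p" "rooted_rel p p" "Y \<omega> = abs_rooted_graph p" by (rule rooted_graph_cases)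
    have "parabolic_graph d (fst p)"
    proof (rule parabolic_of_cheap_cuts)
      show "is_rooted_graph (fst p, snd p)" using p by simp
      show "0 < d" using assms(2) by simp
      fix \<epsilon> :: real assume "0 < \<epsilon>"
      then obtain k where k: "1 / real (Suc k) < \<epsilon>" using nat_approx_posE by blast
      obtain R where "cheap_cut d (1 / real (Suc k)) R p" using * p by (auto simp: cheap_cut_class.abs_eq)
      then have "cheap_cut d \<epsilon> R p" using k unfolding cheap_cut_def by (meson less_imp_le order_trans)
      then show "\<exists>R. cheap_cut d \<epsilon> R (fst p, snd p)" by auto
    qed
    then show "parabolic_rooted_graph d (Y \<omega>)" using p by (simp add: parabolic_rooted_graph.abs_eq)
  qed
qed

end
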